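(* Let $\alpha$ be a continuous rotationally symmetric norm on $L^\infty(\mathbb T)$. Then $$H^\alpha(\mathbb T)=\left\{F\in L^\alpha(\mathbb T):\ \hat F(n)=\int_{\mathbb T}F(z)z^{-n}\,dm(z)=0\ \text{for all } n<0\right\},$$ i.e. $H^\alpha(\mathbb T)$ consists of the functions in $L^\alpha(\mathbb T)$ whose negative Fourier coefficients vanish.
   Context: $\mathbb T$ is the unit circle and $m$ is normalized arc length (Haar measure) on $\mathbb T$; functions equal a.e. are identified. For $w\in\mathbb T$, $f_w(z)=f(\overline wz)$. A continuous rotationally symmetric norm is a norm $\alpha$ on $L^\infty(\mathbb T)$ with $\alpha(1)=1$, $\alpha(|f|)=\alpha(f)$, $\alpha(f_w)=\alpha(f)$ for all $f\in L^\infty(\mathbb T)$, $w\in\mathbb T$, and $\lim_{m(E)\to0^+}\alpha(\chi_E)=0$. For any measurable $f:\mathbb T\to\mathbb C$ put $\alpha(f)=\sup\{\alpha(s):s\text{ a simple function},\ |s|\le|f|\}$. $\mathcal L^\alpha(\mathbb T)$ is the set of measurable $f$ with $\alpha(f)<\infty$, and $L^\alpha(\mathbb T)$ is the $\alpha$-closure of $L^\infty(\mathbb T)$ in $\mathcal L^\alpha(\mathbb T)$ (for continuous $\alpha$ one has $L^\alpha(\mathbb T)\subset L^1(\mathbb T)$). $H^\alpha(\mathbb T)$ is the $\alpha$-closure of the set of polynomials in $z$, i.e. the $\alpha$-closed linear span of $\{1,z,z^2,\ldots\}$. *)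

theory Defs
  imports "HOL-Analysis.Analysis" "HOL-Computational_Algebra.Polynomial"
begin

text \<open>
  Functions on the circle are functions on \<open>complex\<close>; only their values on the unit circle matter,
  because that is the space of \<open>circle_measure\<close>. Functions that are equal almost everywhere are
  not collapsed to classes: every set of functions below is closed under changes on null sets.
\<close>

definition circle_measure :: "complex measure" where
  "circle_measure =
     distr (uniform_measure lborel {0..<2 * pi}) (restrict_space borel (sphere 0 1)) cis"

lemma space_circle_measure [simp]: "space circle_measure = sphere 0 1"
  by (simp add: circle_measure_def space_restrict_space)

lemma sets_circle_measure [simp, measurable_cong]:
  "sets circle_measure = sets (restrict_space borel (sphere 0 1))"
  by (simp add: circle_measure_def)

lemma prob_space_circle_measure: "emeasure circle_measure (space circle_measure) = 1"
proof -
  have "cis \<in> borel_measurable borel"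
    by (intro borel_measurable_continuous_onI continuous_intros)
  then have cis: "cis \<in> measurable (uniform_measure lborel {0..<2 * pi})
      (restrict_space borel (sphere 0 1))"
    by (intro measurable_restrict_space2) auto
  have "emeasure circle_measure (space circle_measure) =
      emeasure (uniform_measure lborel {0..<2 * pi})
        (cis -` sphere 0 1 \<inter> space (uniform_measure lborel {0..<2 * pi}))"
    unfolding space_circle_measure unfolding circle_measure_def
    by (rule emeasure_distr[OF cis]) (auto simp: sets_restrict_space)
  also have "cis -` sphere 0 1 \<inter> space (uniform_measure lborel {0..<2 * pi}) = UNIV"
    by auto
  finally show ?thesis
    by (simp add: divide_eq_1_ennreal)
qed

definition Linf :: "(complex \<Rightarrow> complex) set" where
  "Linf = {f \<in> borel_measurable circle_measure. \<exists>C. AE z in circle_measure. norm (f z) \<le> C}"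

text \<open>
  A norm on the space of classes of essentially bounded functions is a real function on the
  representatives that respects equality almost everywhere. Nothing is assumed about
  the values of \<open>\<alpha>\<close> outside \<open>Linf\<close>, and they are never used.
\<close>

locale continuous_rotationally_symmetric_norm =
  fixes \<alpha> :: "(complex \<Rightarrow> complex) \<Rightarrow> real"
  assumes cong_AE: "\<lbrakk>f \<in> Linf; g \<in> Linf; AE z in circle_measure. f z = g z\<rbrakk> \<Longrightarrow> \<alpha> f = \<alpha> g"
    and nonneg: "f \<in> Linf \<Longrightarrow> 0 \<le> \<alpha> f"
    and eq_0_iff: "f \<in> Linf \<Longrightarrow> \<alpha> f = 0 \<longleftrightarrow> (AE z in circle_measure. f z = 0)"
    and triangle: "\<lbrakk>f \<in> Linf; g \<in> Linf\<rbrakk> \<Longrightarrow> \<alpha> (\<lambda>z. f z + g z) \<le> \<alpha> f + \<alpha> g"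
    and scale: "f \<in> Linf \<Longrightarrow> \<alpha> (\<lambda>z. c * f z) = norm c * \<alpha> f"
    and norm_one: "\<alpha> (\<lambda>z. 1) = 1"
    and norm_abs: "f \<in> Linf \<Longrightarrow> \<alpha> (\<lambda>z. complex_of_real (norm (f z))) = \<alpha> f"
    and rotation: "\<lbrakk>f \<in> Linf; norm w = 1\<rbrakk> \<Longrightarrow> \<alpha> (\<lambda>z. f (cnj w * z)) = \<alpha> f"
    and continuity:
      "\<forall>\<epsilon>>0. \<exists>\<delta>>0. \<forall>E\<in>sets circle_measure.
         0 < measure circle_measure E \<and> measure circle_measure E < \<delta> \<longrightarrow> \<alpha> (indicator E) < \<epsilon>"

definition ext_norm :: "((complex \<Rightarrow> complex) \<Rightarrow> real) \<Rightarrow> (complex \<Rightarrow> complex) \<Rightarrow> ennreal" where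
  "ext_norm \<alpha> f =
     (SUP s \<in> {s. simple_function circle_measure s \<and>
                  (AE z in circle_measure. norm (s z) \<le> norm (f z))}. ennreal (\<alpha> s))"

definition script_L :: "((complex \<Rightarrow> complex) \<Rightarrow> real) \<Rightarrow> (complex \<Rightarrow> complex) set" where
  "script_L \<alpha> = {f \<in> borel_measurable circle_measure. ext_norm \<alpha> f < \<infinity>}"

definition norm_closure ::
    "((complex \<Rightarrow> complex) \<Rightarrow> real) \<Rightarrow> (complex \<Rightarrow> complex) set \<Rightarrow> (complex \<Rightarrow> complex) set" where
  "norm_closure \<alpha> A =
     {f \<in> script_L \<alpha>. \<forall>\<epsilon>>0. \<exists>g\<in>A. ext_norm \<alpha> (\<lambda>z. f z - g z) < ennreal \<epsilon>}"

definition L_space :: "((complex \<Rightarrow> complex) \<Rightarrow> real) \<Rightarrow> (complex \<Rightarrow> complex) set" where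
  "L_space \<alpha> = norm_closure \<alpha> Linf"

definition H_space :: "((complex \<Rightarrow> complex) \<Rightarrow> real) \<Rightarrow> (complex \<Rightarrow> complex) set" where
  "H_space \<alpha> = norm_closure \<alpha> (range (poly :: complex poly \<Rightarrow> complex \<Rightarrow> complex))"

text \<open>
  The Bochner integral of a non-integrable function is 0 by convention. This is harmless for
  members of \<open>L_space \<alpha>\<close>, which are integrable when \<open>\<alpha>\<close> is a continuous norm.
\<close>

definition fourier_coeff :: "(complex \<Rightarrow> complex) \<Rightarrow> int \<Rightarrow> complex" where
  "fourier_coeff F n = (\<integral>z. F z * z powi (- n) \<partial>circle_measure)"

end

theory Submission imports Defs begin

text \<open>
  If \<open>\<bar>f\<bar> \<le> \<bar>g\<bar>\<close>, then \<open>\<bar>f\<bar>\<close> is the average of two functions of modulus \<open>\<bar>g\<bar>\<close>, so that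
  \<open>\<alpha>\<close> is solid. Solidity and continuity make trigonometric polynomials dense in
  \<open>L\<^sup>\<infinity>\<close>, and by rotation invariance Fejer means contract \<open>\<alpha>\<close>. The mean of order 1 is the constant
  coefficient, so that \<open>\<alpha>\<close> dominates the norm of \<open>L\<^sup>1\<close> and Fourier coefficients are continuous on
  \<open>L\<^sup>\<alpha>\<close>. This gives one inclusion. For the other, the Fejer means of a function whose negative coefficients
  vanish converge to it and have no negative frequencies.
\<close>

section \<open>Bounded functions and trigonometric polynomials on the circle\<close>

text \<open>Approximating F gives trigonometric polynomials whose negative coefficients are small
  but uncontrolled in number, and deleting them is the Riesz projection, which is unbounded for
  general norms (for the L1 norm, say). The Fejer multipliers are contractions and leave fewer than
  N negative frequencies; that is why they are used. The order 1 mean bounds only the modulus of the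
  integral of a polynomial. To reach the L1 norm, the bound is applied to approximations of the
  modulus of a function, and then the integral of the error must be small too, although \<alpha> is
  not yet known to control it. Hence density is proved for all solid continuous seminorms and used
  for the sum of \<alpha> and the L1 norm, which yields one polynomial close in both senses.\<close>

interpretation circle: finite_measure circle_measure
  by standard (simp add: prob_space_circle_measure del: space_circle_measure)

lemma measure_circle: "measure circle_measure (sphere 0 1) = 1"
  using prob_space_circle_measure by (simp add: measure_def)

text \<open>\<open>F\<close> is an antiderivative of the monomial in the angle variable, available
  because \<open>n \<noteq> 0\<close>; it takes equal values at 0 and 2 pi because \<open>n\<close>
  is an integer.\<close>

lemma integral_circle_powi:
  assumes "n \<noteq> 0"
  shows "(\<integral>z. z powi n \<partial>circle_measure) = 0"
proof -
  define F :: "real \<Rightarrow> complex" where "F = (\<lambda>x. cis (of_int n * x) / (\<i> * of_int n))"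
  have meas_cis: "cis \<in> borel_measurable borel"
    by (intro borel_measurable_continuous_onI continuous_intros)
  have cis_n [measurable]: "(\<lambda>x. cis (of_int n * x)) \<in> borel_measurable borel"
    by (intro borel_measurable_continuous_onI continuous_intros)
  from meas_cis have cis: "cis \<in> measurable (uniform_measure lborel {0..<2 * pi})
      (restrict_space borel (sphere 0 1))"
    by (intro measurable_restrict_space2) auto
  have powi: "(\<lambda>z::complex. z powi n) \<in> borel_measurable (restrict_space borel (sphere 0 1))"
    by (intro borel_measurable_continuous_on_restrict continuous_intros) auto
  have dens: "uniform_measure lborel {0..<2 * pi} =
      density lborel (\<lambda>x. ennreal (indicator {0..<2 * pi} x / (2 * pi)))"
    unfolding uniform_measure_def
  proof (intro density_cong AE_I2)
    fix x :: real
    have "(1::ennreal) / ennreal (2 * pi) = ennreal (1 / (2 * pi))"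
      using divide_ennreal[of 1 "2 * pi"] by simp
    then show "indicator {0..<2 * pi} x / emeasure lborel {0..<2 * pi} =
        ennreal (indicator {0..<2 * pi} x / (2 * pi))"
      by (cases "x \<in> {0..<2 * pi}") simp_all
  qed measurable
  have "(\<integral>z. z powi n \<partial>circle_measure) =
      (\<integral>x. cis (of_int n * x) \<partial>uniform_measure lborel {0..<2 * pi})"
    unfolding circle_measure_def by (subst integral_distr[OF cis powi]) (simp add: cis_power_int)
  also have "\<dots> = (\<integral>x. (indicator {0..<2 * pi} x / (2 * pi)) *\<^sub>R cis (of_int n * x) \<partial>lborel)"
    unfolding dens
    by (subst integral_density) auto
  \<comment> \<open>The circle is parametrized by a half-open interval, whereas the fundamental
    theorem of calculus is applied on the closed one; the endpoint is a null set.\<close>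
  also have "\<dots> = (\<integral>x. inverse (2 * pi) *\<^sub>R (indicator {0..2 * pi} x *\<^sub>R cis (of_int n * x)) \<partial>lborel)"
  proof (rule integral_cong_AE)
    show "AE x in lborel. (indicator {0..<2 * pi} x / (2 * pi)) *\<^sub>R cis (of_int n * x) =
        inverse (2 * pi) *\<^sub>R (indicator {0..2 * pi} x *\<^sub>R cis (of_int n * x))"
      using AE_lborel_singleton[of "2 * pi"]
    proof eventually_elim
      fix x :: real assume "x \<noteq> 2 * pi"
      then have "indicator {0..<2 * pi} x = (indicator {0..2 * pi} x :: real)"
        by (simp add: indicator_def less_le)
      then show "(indicator {0..<2 * pi} x / (2 * pi)) *\<^sub>R cis (of_int n * x) =
          inverse (2 * pi) *\<^sub>R (indicator {0..2 * pi} x *\<^sub>R cis (of_int n * x))"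
        by (simp only: scaleR_scaleR divide_inverse mult.commute)
    qed
  qed measurable
  also have "\<dots> = inverse (2 * pi) *\<^sub>R (\<integral>x. indicator {0..2 * pi} x *\<^sub>R cis (of_int n * x) \<partial>lborel)"
    by (rule integral_scaleR_right)
  also have "(\<integral>x. indicator {0..2 * pi} x *\<^sub>R cis (of_int n * x) \<partial>lborel) = F (2 * pi) - F 0"
  proof (rule integral_FTC_atLeastAtMost)
    fix x :: real
    have "((\<lambda>w. exp (\<i> * of_int n * w) / (\<i> * of_int n)) has_field_derivative
        exp (\<i> * of_int n * of_real x)) (at (of_real x))"
      by (rule derivative_eq_intros refl | simp add: assms)+
    from has_vector_derivative_real_field[OF this]
    show "(F has_vector_derivative cis (of_int n * x)) (at x within {0..2 * pi})"
      unfolding F_def cis_conv_exp by (simp add: mult.assoc)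
  qed (auto intro!: continuous_intros)
  also have "F (2 * pi) - F 0 = 0"
    by (simp add: F_def flip: cis_power_int)
  finally show ?thesis by simp
qed

text \<open>Frequencies and coefficients are kept apart so that a Fourier multiplier acts on
  \<open>c\<close> alone. For infinite \<open>S\<close> the sum is 0 by convention, so continuity
  and boundedness hold for every \<open>S\<close>.\<close>

definition trig :: "int set \<Rightarrow> (int \<Rightarrow> complex) \<Rightarrow> complex \<Rightarrow> complex" where
  "trig S c z = (\<Sum>n\<in>S. c n * z powi n)"

lemma continuous_on_trig: "continuous_on (sphere 0 1) (trig S c)"
  unfolding trig_def by (intro continuous_intros) auto

section \<open>Closure properties of the bounded functions\<close>

lemma LinfI_bounded:
  assumes "f \<in> borel_measurable circle_measure" "\<And>z. norm z = 1 \<Longrightarrow> norm (f z) \<le> C"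
  shows "f \<in> Linf"
  using assms unfolding Linf_def by (auto intro!: exI[of _ C] AE_I2)

lemma measurable_continuous_circle:
  assumes "continuous_on (sphere 0 1) f"
  shows "f \<in> borel_measurable circle_measure"
  using borel_measurable_continuous_on_restrict[OF assms] by simp

lemma Linf_continuous:
  fixes f :: "complex \<Rightarrow> complex"
  assumes "continuous_on (sphere 0 1) f"
  shows "f \<in> Linf"
proof -
  have "bounded (f ` sphere 0 1)"
    by (intro compact_imp_bounded compact_continuous_image assms) auto
  then obtain C where "\<forall>w\<in>f ` sphere 0 1. norm w \<le> C"
    unfolding bounded_iff by blast
  then have "\<And>z. norm z = 1 \<Longrightarrow> norm (f z) \<le> C" by simp
  with measurable_continuous_circle[OF assms] show ?thesis by (rule LinfI_bounded)
qed

lemma Linf_trig: "trig S c \<in> Linf"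
  by (intro Linf_continuous continuous_on_trig)

lemma Linf_measurable: "f \<in> Linf \<Longrightarrow> f \<in> borel_measurable circle_measure"
  by (simp add: Linf_def)

lemma Linf_const: "(\<lambda>z. c) \<in> Linf"
  by (intro Linf_continuous continuous_intros)

lemma Linf_dominated:
  assumes "f \<in> borel_measurable circle_measure" "g \<in> Linf"
    and "AE z in circle_measure. norm (f z) \<le> norm (g z)"
  shows "f \<in> Linf"
proof -
  from assms(2) obtain C where "AE z in circle_measure. norm (g z) \<le> C"
    by (auto simp: Linf_def)
  with assms(3) have "AE z in circle_measure. norm (f z) \<le> C"
    by eventually_elim simp
  with assms(1) show ?thesis by (auto simp: Linf_def)
qed

lemma Linf_add:
  assumes "f \<in> Linf" "g \<in> Linf"
  shows "(\<lambda>z. f z + g z) \<in> Linf"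
proof -
  from assms obtain C D where CD: "AE z in circle_measure. norm (f z) \<le> C"
      "AE z in circle_measure. norm (g z) \<le> D"
    by (auto simp: Linf_def)
  have "AE z in circle_measure. norm (f z + g z) \<le> C + D"
    using CD by eventually_elim (rule norm_triangle_mono)
  then show ?thesis
    using assms by (auto simp: Linf_def)
qed

lemma Linf_scale:
  assumes "f \<in> Linf"
  shows "(\<lambda>z. c * f z) \<in> Linf"
proof -
  from assms obtain C where "AE z in circle_measure. norm (f z) \<le> C"
    by (auto simp: Linf_def)
  then have "AE z in circle_measure. norm (c * f z) \<le> norm c * C"
    by eventually_elim (simp add: norm_mult mult_left_mono)
  then show ?thesis
    using assms by (auto simp: Linf_def)
qed

lemma Linf_diff: "f \<in> Linf \<Longrightarrow> g \<in> Linf \<Longrightarrow> (\<lambda>z. f z - g z) \<in> Linf"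
  using Linf_add[OF _ Linf_scale, of f g "-1"] by simp

lemma Linf_sum:
  "(\<And>i. i \<in> I \<Longrightarrow> f i \<in> Linf) \<Longrightarrow> (\<lambda>z. \<Sum>i\<in>I. f i z) \<in> Linf"
  by (induction I rule: infinite_finite_induct) (auto intro: Linf_add simp: Linf_const)

lemma Linf_norm:
  assumes "f \<in> Linf" shows "(\<lambda>z. complex_of_real (norm (f z))) \<in> Linf"
  using assms by (intro Linf_dominated[OF _ assms]) (auto dest: Linf_measurable)

lemma Linf_indicator: "E \<in> sets circle_measure \<Longrightarrow> indicator E \<in> Linf"
  by (rule LinfI_bounded[of _ 1]) (auto split: split_indicator)

lemma Linf_simple:
  assumes "simple_function circle_measure f"
  shows "f \<in> Linf"
proof -
  have "bounded (f ` sphere 0 1)"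
    using simple_functionD(1)[OF assms] by (auto intro: finite_imp_bounded)
  then obtain C where "\<forall>w\<in>f ` sphere 0 1. norm w \<le> C"
    unfolding bounded_iff by blast
  then have "\<And>z. norm z = 1 \<Longrightarrow> norm (f z) \<le> C" by simp
  with borel_measurable_simple_function[OF assms] show ?thesis by (rule LinfI_bounded)
qed

lemma Linf_integrable:
  assumes "f \<in> Linf" shows "integrable circle_measure f"
  using assms circle.integrable_const_bound[of f] by (auto simp: Linf_def)

lemma Linf_poly: "poly p \<in> Linf"
  by (intro Linf_continuous continuous_intros)

lemma fourier_coeff_trig:
  assumes "finite S"
  shows "fourier_coeff (trig S c) n = (if n \<in> S then c n else 0)"
proof -
  have int: "integrable circle_measure (\<lambda>z. z powi k)" for k
    by (intro Linf_integrable Linf_continuous continuous_intros) auto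
  have "fourier_coeff (trig S c) n =
      (\<integral>z. (\<Sum>k\<in>S. c k * z powi (k - n)) \<partial>circle_measure)"
    unfolding fourier_coeff_def
  proof (rule Bochner_Integration.integral_cong[OF refl])
    fix z :: complex assume "z \<in> space circle_measure"
    then have "z \<noteq> 0" by auto
    then show "trig S c z * z powi (- n) = (\<Sum>k\<in>S. c k * z powi (k - n))"
      unfolding trig_def sum_distrib_right
      by (intro sum.cong refl) (simp add: power_int_diff power_int_minus field_simps)
  qed
  also have "\<dots> = (\<Sum>k\<in>S. c k * (\<integral>z. z powi (k - n) \<partial>circle_measure))"
    by (simp add: int)
  also have "\<dots> = (\<Sum>k\<in>S. if k = n then c k else 0)"
    by (intro sum.cong refl) (auto simp: integral_circle_powi measure_circle)
  also have "\<dots> = (if n \<in> S then c n else 0)" using assms by simp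
  finally show ?thesis .
qed

text \<open>Padding with zeros moves two polynomials to a common frequency set, where sums and
  differences are taken coefficientwise.\<close>

lemma trig_superset:
  assumes "finite U" "S \<subseteq> U"
  shows "trig U (\<lambda>n. if n \<in> S then c n else 0) z = trig S c z"
proof -
  have "trig U (\<lambda>n. if n \<in> S then c n else 0) z = (\<Sum>n\<in>U. if n \<in> S then c n * z powi n else 0)"
    unfolding trig_def by (intro sum.cong) auto
  with assms show ?thesis
    by (simp add: trig_def sum.inter_restrict[symmetric] Int_absorb1)
qed

lemma trig_diff: "trig S c z - trig S d z = trig S (\<lambda>n. c n - d n) z"
  by (simp add: trig_def sum_subtractf algebra_simps)

text \<open>Collects what the density argument uses. The value at the constant 1 is left free
  because the locale is instantiated by the given norm and also by its sum with the L1 norm, where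
  that value is 2.\<close>

locale circle_norm =
  fixes \<alpha> :: "(complex \<Rightarrow> complex) \<Rightarrow> real"
  assumes nonneg: "f \<in> Linf \<Longrightarrow> 0 \<le> \<alpha> f"
    and triangle: "\<lbrakk>f \<in> Linf; g \<in> Linf\<rbrakk> \<Longrightarrow> \<alpha> (\<lambda>z. f z + g z) \<le> \<alpha> f + \<alpha> g"
    and scale: "f \<in> Linf \<Longrightarrow> \<alpha> (\<lambda>z. c * f z) = norm c * \<alpha> f"
    and mono: "\<lbrakk>f \<in> Linf; g \<in> Linf; AE z in circle_measure. norm (f z) \<le> norm (g z)\<rbrakk>
      \<Longrightarrow> \<alpha> f \<le> \<alpha> g"
    and continuity: "0 < \<epsilon> \<Longrightarrow> \<exists>\<delta>>0. \<forall>E\<in>sets circle_measure.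
         measure circle_measure E < \<delta> \<longrightarrow> \<alpha> (indicator E) < \<epsilon>"
begin

lemma cong:
  assumes "f \<in> Linf" "g \<in> Linf" "\<And>z. norm z = 1 \<Longrightarrow> f z = g z"
  shows "\<alpha> f = \<alpha> g"
  using assms by (intro antisym mono) auto

lemma le_const:
  assumes "f \<in> Linf" "\<And>z. norm z = 1 \<Longrightarrow> norm (f z) \<le> C" "0 \<le> C"
  shows "\<alpha> f \<le> C * \<alpha> (\<lambda>z. 1)"
proof -
  have "\<alpha> f \<le> \<alpha> (\<lambda>z. of_real C * 1)"
    using assms by (intro mono Linf_const) auto
  then show ?thesis
    using assms(3) by (simp only: scale[OF Linf_const]) simp
qed

lemma sum:
  assumes "finite I" "\<And>i. i \<in> I \<Longrightarrow> f i \<in> Linf"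
  shows "\<alpha> (\<lambda>z. \<Sum>i\<in>I. f i z) \<le> (\<Sum>i\<in>I. \<alpha> (f i))"
  using assms
proof (induction I)
  case empty
  show ?case using scale[OF Linf_const, of 0 0] by simp
next
  case (insert i I)
  have "\<alpha> (\<lambda>z. f i z + (\<Sum>i\<in>I. f i z)) \<le> \<alpha> (f i) + \<alpha> (\<lambda>z. \<Sum>i\<in>I. f i z)"
    using insert.prems by (intro triangle Linf_sum) auto
  with insert show ?case by auto
qed

lemma diff_triangle:
  assumes "f \<in> Linf" "g \<in> Linf" "h \<in> Linf"
  shows "\<alpha> (\<lambda>z. f z - h z) \<le> \<alpha> (\<lambda>z. f z - g z) + \<alpha> (\<lambda>z. g z - h z)"
  using triangle[of "\<lambda>z. f z - g z" "\<lambda>z. g z - h z"] assms by (simp add: Linf_diff)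

lemma diff_commute:
  assumes "f \<in> Linf" "g \<in> Linf"
  shows "\<alpha> (\<lambda>z. f z - g z) = \<alpha> (\<lambda>z. g z - f z)"
  using assms by (intro antisym mono Linf_diff) (auto simp: norm_minus_commute)

end

section \<open>Density of trigonometric polynomials\<close>

text \<open>On the circle \<open>cnj z\<close> is the inverse of \<open>z\<close>, so a polynomial
  in the real coordinates becomes a polynomial in \<open>z\<close> after multiplication by a power
  of \<open>z\<close>. This adapts the Stone-Weierstrass theorem to trigonometric
  polynomials.\<close>

lemma trig_if_polynomial_function:
  fixes g :: "complex \<Rightarrow> complex"
  assumes "polynomial_function g"
  shows "\<exists>S c. finite S \<and> (\<forall>z. norm z = 1 \<longrightarrow> g z = trig S c z)"
proof -
  \<comment> \<open>Clearing negative powers makes the class visibly closed under sums and products;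
    the shift by \<open>D\<close> is undone at the end.\<close>
  define P where "P = (\<lambda>f::complex \<Rightarrow> complex. \<exists>D p. \<forall>z. norm z = 1 \<longrightarrow> f z * z ^ D = poly p z)"
  have P_const: "P (\<lambda>z. c)" for c
    unfolding P_def by (intro exI[of _ 0] exI[of _ "[:c:]"]) simp
  have P_add: "P (\<lambda>z. f z + g z)" if "P f" "P g" for f g
  proof -
    from that obtain D p E q where "\<And>z. norm z = 1 \<Longrightarrow> f z * z ^ D = poly p z"
        "\<And>z. norm z = 1 \<Longrightarrow> g z * z ^ E = poly q z"
      unfolding P_def by blast
    then have "(f z * z ^ D) * z ^ E + (g z * z ^ E) * z ^ D =
        poly (p * monom 1 E + q * monom 1 D) z" if "norm z = 1" for z
      using that by (simp add: poly_monom)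
    then show ?thesis unfolding P_def
      by (intro exI[of _ "D + E"] exI[of _ "p * monom 1 E + q * monom 1 D"])
        (simp add: power_add algebra_simps)
  qed
  have P_mult: "P (\<lambda>z. f z * g z)" if "P f" "P g" for f g
  proof -
    from that obtain D p E q where "\<And>z. norm z = 1 \<Longrightarrow> f z * z ^ D = poly p z"
        "\<And>z. norm z = 1 \<Longrightarrow> g z * z ^ E = poly q z"
      unfolding P_def by blast
    then have "(f z * z ^ D) * (g z * z ^ E) = poly (p * q) z" if "norm z = 1" for z
      using that by simp
    then show ?thesis unfolding P_def
      by (intro exI[of _ "D + E"] exI[of _ "p * q"]) (auto simp: power_add mult_ac)
  qed
  have P_cong: "P f \<longleftrightarrow> P g" if "\<And>z. norm z = 1 \<Longrightarrow> f z = g z" for f g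
    unfolding P_def using that by simp
  have P_id: "P (\<lambda>z. z)"
    unfolding P_def by (intro exI[of _ 0] exI[of _ "[:0, 1:]"]) simp
  have P_cnj: "P cnj"
    unfolding P_def
    by (intro exI[of _ 1] exI[of _ "[:1:]"])
      (auto simp: mult.commute complex_norm_square[symmetric])
  have P_real: "P (\<lambda>z. complex_of_real (h z))" if "real_polynomial_function h" for h
    using that
  proof induction
    case (linear h)
    interpret bounded_linear h by fact
    define a b where "a = h 1" and "b = h \<i>"
    have hz: "h z = Re z * a + Im z * b" for z
    proof -
      have "h z = h (Re z *\<^sub>R 1 + Im z *\<^sub>R \<i>)"
        by (rule arg_cong[of _ _ h]) (simp add: complex_eq_iff)
      then show ?thesis by (simp add: add scaleR a_def b_def)
    qed
    \<comment> \<open>The real part of (a - i b) z, written as half the sum of this number and its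
      conjugate.\<close>
    have "complex_of_real (h z) = (of_real a / 2 - of_real b * \<i> / 2) * z +
        (of_real a / 2 + of_real b * \<i> / 2) * cnj z" for z
      unfolding hz by (simp add: complex_eq_iff)
    then show ?case
      by (simp only:) (intro P_add P_mult P_const P_id P_cnj)
  qed (auto simp: P_const intro: P_add P_mult)
  have "real_polynomial_function (\<lambda>z. Re (g z))" "real_polynomial_function (\<lambda>z. Im (g z))"
    using assms unfolding polynomial_function_def
    using bounded_linear_Re bounded_linear_Im by (auto simp: o_def)
  then have "P (\<lambda>z. of_real (Re (g z)) + \<i> * of_real (Im (g z)))"
    by (intro P_add P_mult P_const P_real)
  then have "P g"
    by (simp flip: complex_eq)
  then obtain D p where Dp: "\<And>z. norm z = 1 \<Longrightarrow> g z * z ^ D = poly p z"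
    unfolding P_def by blast
  define e where "e = (\<lambda>i. int i - int D)"
  have "g z = trig (e ` {..degree p}) (\<lambda>n. coeff p (nat (n + int D))) z" if "norm z = 1" for z
  proof -
    have z: "z \<noteq> 0" using that by auto
    have "trig (e ` {..degree p}) (\<lambda>n. coeff p (nat (n + int D))) z =
        (\<Sum>i\<le>degree p. coeff p i * z powi (int i - int D))"
      unfolding trig_def by (subst sum.reindex) (auto simp: e_def inj_on_def)
    also have "\<dots> = (\<Sum>i\<le>degree p. coeff p i * z ^ i) / z ^ D"
      using z by (simp add: sum_divide_distrib power_int_diff)
    also have "\<dots> = g z"
      using Dp[OF that] z by (simp add: poly_altdef field_simps)
    finally show ?thesis by simp
  qed
  then show ?thesis
    by (intro exI[of _ "e ` {..degree p}"] exI[of _ "\<lambda>n. coeff p (nat (n + int D))"]) simp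
qed

text \<open>Rounding down, not to the nearest point, makes the resulting simple functions minorants,
  as \<open>ext_norm\<close> demands. \<open>Suc n\<close> keeps the mesh finite at
  \<open>n = 0\<close>.\<close>

definition grid :: "nat \<Rightarrow> real \<Rightarrow> real" where
  "grid n x = of_int \<lfloor>x * real (Suc n)\<rfloor> / real (Suc n)"

lemma grid_le: "grid n x \<le> x"
  unfolding grid_def by (simp add: divide_le_eq)

lemma grid_nonneg: "0 \<le> x \<Longrightarrow> 0 \<le> grid n x"
  unfolding grid_def by simp

lemma grid_error: "\<bar>x - grid n x\<bar> \<le> inverse (Suc n)"
proof -
  define y where "y = x * real (Suc n)"
  have "x - grid n x = (y - of_int \<lfloor>y\<rfloor>) / real (Suc n)"
    by (simp add: grid_def y_def diff_divide_distrib)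
  also have "\<dots> \<le> 1 / real (Suc n)"
    by (intro divide_right_mono) linarith+
  finally have "x - grid n x \<le> inverse (Suc n)"
    by (simp add: divide_inverse)
  with grid_le[of n x] show ?thesis by simp
qed

lemma measurable_grid [measurable]: "grid n \<in> borel_measurable borel"
  unfolding grid_def by measurable

lemma finite_grid:
  assumes "\<And>x. x \<in> A \<Longrightarrow> \<bar>h x\<bar> \<le> C"
  shows "finite ((\<lambda>x. grid n (h x)) ` A)"
proof (rule finite_subset)
  show "(\<lambda>x. grid n (h x)) ` A \<subseteq>
      (\<lambda>k. of_int k / Suc n) ` {\<lfloor>- C * Suc n\<rfloor>..\<lfloor>C * Suc n\<rfloor>}"
  proof safe
    fix x assume "x \<in> A"
    then have "- C \<le> h x" "h x \<le> C" using assms[of x] by auto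
    then have "- C * Suc n \<le> h x * Suc n" "h x * Suc n \<le> C * Suc n"
      by (intro mult_right_mono; simp)+
    then show "grid n (h x) \<in> (\<lambda>k. of_int k / Suc n) ` {\<lfloor>- C * Suc n\<rfloor>..\<lfloor>C * Suc n\<rfloor>}"
      unfolding grid_def by (intro imageI) (auto intro: floor_mono)
  qed
qed simp

section \<open>Density, extended from continuous functions to indicators, simple functions and all
  of \<open>Linf\<close>\<close>

context circle_norm
begin

definition approx :: "(complex \<Rightarrow> complex) \<Rightarrow> bool" where
  "approx f \<longleftrightarrow> (\<forall>\<epsilon>>0. \<exists>S c. finite S \<and> \<alpha> (\<lambda>z. f z - trig S c z) < \<epsilon>)"

text \<open>The approximable functions form an \<alpha>-closed set; each stage of the density proof
  approximates by functions of the previous one.\<close>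

lemma approxI:
  assumes "f \<in> Linf" "\<And>\<epsilon>. 0 < \<epsilon> \<Longrightarrow> \<exists>g\<in>Linf. approx g \<and> \<alpha> (\<lambda>z. f z - g z) < \<epsilon>"
  shows "approx f"
  unfolding approx_def
proof (intro allI impI)
  fix \<epsilon> :: real assume "0 < \<epsilon>"
  then obtain g where g: "g \<in> Linf" "approx g" "\<alpha> (\<lambda>z. f z - g z) < \<epsilon> / 2"
    using assms(2)[of "\<epsilon> / 2"] by auto
  with \<open>0 < \<epsilon>\<close> obtain S c where Sc: "finite S" "\<alpha> (\<lambda>z. g z - trig S c z) < \<epsilon> / 2"
    unfolding approx_def using half_gt_zero by blast
  have "\<alpha> (\<lambda>z. f z - trig S c z) < \<epsilon>"
    using diff_triangle[OF assms(1) g(1) Linf_trig, of S c] g(3) Sc(2) by linarith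
  with Sc(1) show "\<exists>S c. finite S \<and> \<alpha> (\<lambda>z. f z - trig S c z) < \<epsilon>" by blast
qed

lemma approxI_uniform:
  assumes "f \<in> Linf"
    and "\<And>\<epsilon>. 0 < \<epsilon> \<Longrightarrow> \<exists>g\<in>Linf. approx g \<and> (\<forall>z. norm z = 1 \<longrightarrow> norm (f z - g z) \<le> \<epsilon>)"
  shows "approx f"
proof (rule approxI[OF assms(1)])
  fix \<epsilon> :: real assume "0 < \<epsilon>"
  \<comment> \<open>The summand 1 keeps the denominator positive, since \<open>circle_norm\<close>
    allows the constant 1 to have norm 0.\<close>
  define \<delta> where "\<delta> = \<epsilon> / (\<alpha> (\<lambda>z. 1) + 1)"
  have one: "0 \<le> \<alpha> (\<lambda>z. 1)" by (intro nonneg Linf_const)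
  then have "0 < \<delta>" using \<open>0 < \<epsilon>\<close> by (simp add: \<delta>_def)
  then obtain g where g: "g \<in> Linf" "approx g" "\<And>z. norm z = 1 \<Longrightarrow> norm (f z - g z) \<le> \<delta>"
    using assms(2) by blast
  have "\<alpha> (\<lambda>z. f z - g z) \<le> \<delta> * \<alpha> (\<lambda>z. 1)"
    using g \<open>0 < \<delta>\<close> assms(1) by (intro le_const Linf_diff) auto
  also have "\<dots> < \<delta> * (\<alpha> (\<lambda>z. 1) + 1)" using \<open>0 < \<delta>\<close> by simp
  also have "\<dots> = \<epsilon>" using one by (simp add: \<delta>_def)
  finally show "\<exists>g\<in>Linf. approx g \<and> \<alpha> (\<lambda>z. f z - g z) < \<epsilon>" using g by blast
qed

lemma approx_trig: "finite S \<Longrightarrow> approx (trig S c)"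
  unfolding approx_def using scale[OF Linf_const, of 0 0]
  by (auto intro!: exI[of _ S] exI[of _ c])

lemma approx_continuous:
  assumes "continuous_on (sphere 0 1) f"
  shows "approx f"
proof (rule approxI_uniform)
  show "f \<in> Linf" by (intro Linf_continuous assms)
  fix \<epsilon> :: real assume "0 < \<epsilon>"
  then obtain g where g: "polynomial_function g" "\<forall>z\<in>sphere 0 1. norm (f z - g z) < \<epsilon>"
    using Stone_Weierstrass_polynomial_function[OF _ assms] by auto
  obtain S c where "finite S" "\<And>z. norm z = 1 \<Longrightarrow> g z = trig S c z"
    using trig_if_polynomial_function[OF g(1)] by blast
  with g(2) show "\<exists>g\<in>Linf. approx g \<and> (\<forall>z. norm z = 1 \<longrightarrow> norm (f z - g z) \<le> \<epsilon>)"
    by (intro bexI[of _ "trig S c"] Linf_trig) (auto simp: approx_trig less_imp_le)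
qed

lemma approx_scale:
  assumes "f \<in> Linf" "approx f" shows "approx (\<lambda>z. k * f z)"
  unfolding approx_def
proof (intro allI impI)
  fix \<epsilon> :: real assume "0 < \<epsilon>"
  then have "0 < \<epsilon> / (norm k + 1)"
    by (intro divide_pos_pos) (auto intro: add_nonneg_pos)
  with assms(2) obtain S c where Sc: "finite S" "\<alpha> (\<lambda>z. f z - trig S c z) < \<epsilon> / (norm k + 1)"
    unfolding approx_def by blast
  have "\<alpha> (\<lambda>z. k * f z - trig S (\<lambda>n. k * c n) z) = \<alpha> (\<lambda>z. k * (f z - trig S c z))"
    by (simp add: trig_def sum_distrib_left algebra_simps)
  also have "\<dots> = norm k * \<alpha> (\<lambda>z. f z - trig S c z)"
    by (intro scale Linf_diff assms Linf_trig)
  also have "\<dots> \<le> norm k * (\<epsilon> / (norm k + 1))"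
    using Sc by (intro mult_left_mono) auto
  also have "\<dots> < \<epsilon>"
  proof -
    have "norm k / (norm k + 1) < 1"
      by (subst divide_less_eq_1_pos) (auto intro: add_nonneg_pos)
    then have "(norm k / (norm k + 1)) * \<epsilon> < 1 * \<epsilon>"
      using \<open>0 < \<epsilon>\<close> by (rule mult_strict_right_mono)
    then show ?thesis by simp
  qed
  finally show "\<exists>S c. finite S \<and> \<alpha> (\<lambda>z. k * f z - trig S c z) < \<epsilon>"
    using Sc(1) by blast
qed

lemma approx_add:
  assumes "f \<in> Linf" "approx f" "g \<in> Linf" "approx g" shows "approx (\<lambda>z. f z + g z)"
  unfolding approx_def
proof (intro allI impI)
  fix \<epsilon> :: real assume "0 < \<epsilon>"
  then obtain S c T d where Sc: "finite S" "\<alpha> (\<lambda>z. f z - trig S c z) < \<epsilon> / 2"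
      and Td: "finite T" "\<alpha> (\<lambda>z. g z - trig T d z) < \<epsilon> / 2"
    using assms(2,4) unfolding approx_def by (meson half_gt_zero)
  define e where "e = (\<lambda>n. (if n \<in> S then c n else 0) + (if n \<in> T then d n else 0))"
  have "trig (S \<union> T) e z = trig S c z + trig T d z" for z
    using Sc(1) Td(1)
    by (subst (1 2) trig_superset[of "S \<union> T", symmetric])
      (auto simp: trig_def e_def sum.distrib algebra_simps simp flip: sum.distrib)
  then have "\<alpha> (\<lambda>z. (f z + g z) - trig (S \<union> T) e z) =
      \<alpha> (\<lambda>z. (f z - trig S c z) + (g z - trig T d z))"
    by (simp add: algebra_simps)
  also have "\<dots> \<le> \<alpha> (\<lambda>z. f z - trig S c z) + \<alpha> (\<lambda>z. g z - trig T d z)"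
    by (intro triangle Linf_diff assms Linf_trig)
  also have "\<dots> < \<epsilon>" using Sc Td by simp
  finally show "\<exists>S c. finite S \<and> \<alpha> (\<lambda>z. (f z + g z) - trig S c z) < \<epsilon>"
    using Sc(1) Td(1) by blast
qed

lemma approx_sum:
  assumes "finite I" "\<And>i. i \<in> I \<Longrightarrow> f i \<in> Linf" "\<And>i. i \<in> I \<Longrightarrow> approx (f i)"
  shows "approx (\<lambda>z. \<Sum>i\<in>I. f i z)"
  using assms
proof (induction I)
  case empty
  show ?case using approx_continuous[of "\<lambda>z. 0"] by simp
next
  case (insert i I)
  then show ?case by (simp add: approx_add Linf_sum)
qed

text \<open>The only use of continuity in the density proof. Regularity encloses \<open>E\<close>
  between a closed \<open>K\<close> and an open \<open>U\<close> with \<open>U - K\<close> of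
  measure below \<delta>; a Urysohn function for them differs from the indicator only on
  \<open>U - K\<close> and by at most 1, so solidity bounds the error by the norm of an indicator of
  a small set.\<close>

lemma approx_indicator:
  assumes "E \<in> sets circle_measure"
  shows "approx (indicator E)"
proof (rule approxI[OF Linf_indicator[OF assms]])
  fix \<epsilon> :: real assume "0 < \<epsilon>"
  then obtain \<delta> where \<delta>: "0 < \<delta>"
      "\<And>E. E \<in> sets circle_measure \<Longrightarrow> measure circle_measure E < \<delta> \<Longrightarrow> \<alpha> (indicator E) < \<epsilon>"
    using continuity by blast
  \<comment> \<open>The measure is transported to the plane, so that regularity and Urysohn's lemma
    use sets closed or open in the plane itself.\<close>
  define M where "M = distr circle_measure borel (\<lambda>z. z)"
  have id [measurable]: "(\<lambda>z. z) \<in> measurable circle_measure borel"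
    by (intro measurable_continuous_circle continuous_intros)
  interpret M: finite_measure M
    unfolding M_def by (rule circle.finite_measure_distr) simp
  have sets_M: "sets M = sets borel" by (simp add: M_def)
  have meas: "measure M B = measure circle_measure (B \<inter> sphere 0 1)" if "B \<in> sets borel" for B
    unfolding M_def using that by (subst measure_distr) auto
  have sph: "sphere (0::complex) 1 \<in> sets borel" by simp
  from assms have E: "E \<in> sets borel" "E \<subseteq> sphere 0 1"
    by (auto simp: sets_restrict_space_iff)
  have fin: "emeasure M (space M) \<noteq> \<infinity>" by simp
  have "\<exists>K. closed K \<and> K \<subseteq> E \<and> measure M E < measure M K + \<delta> / 2"
  proof (rule ccontr)
    assume *: "\<not> ?thesis"
    have "emeasure M E \<le> ennreal (measure M E - \<delta> / 2)"
      unfolding inner_regular[OF sets_M fin E(1)]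
    proof (rule SUP_least)
      fix K assume "K \<in> {K. K \<subseteq> E \<and> compact K}"
      then have "\<not> measure M E < measure M K + \<delta> / 2" using * compact_imp_closed by blast
      then show "emeasure M K \<le> ennreal (measure M E - \<delta> / 2)"
        by (simp add: M.emeasure_eq_measure ennreal_leI)
    qed
    \<comment> \<open>\<open>ennreal\<close> sends negative reals to 0, hence the
      \<open>max\<close>. What remains is a null set \<open>E\<close>, for which the empty set
      serves as \<open>K\<close>.\<close>
    then have "measure M E \<le> max 0 (measure M E - \<delta> / 2)"
      by (simp add: M.emeasure_eq_measure ennreal_le_iff2) linarith
    with \<delta>(1) have "measure M E = 0" by (auto simp: max_def order_antisym split: if_splits)
    with * \<delta>(1) show False by (auto dest: spec[of _ "{}"])
  qed
  then obtain K where K: "closed K" "K \<subseteq> E" "measure M E < measure M K + \<delta> / 2" by blast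
  have "\<exists>U. open U \<and> E \<subseteq> U \<and> measure M U < measure M E + \<delta> / 2"
  proof (rule ccontr)
    assume *: "\<not> ?thesis"
    have "ennreal (measure M E + \<delta> / 2) \<le> emeasure M E"
      unfolding outer_regular[OF sets_M fin E(1)]
    proof (rule INF_greatest)
      fix U assume "U \<in> {U. E \<subseteq> U \<and> open U}"
      then have "\<not> measure M U < measure M E + \<delta> / 2" using * by blast
      then show "ennreal (measure M E + \<delta> / 2) \<le> emeasure M U"
        by (simp add: M.emeasure_eq_measure ennreal_leI)
    qed
    then have "measure M E + \<delta> / 2 \<le> measure M E"
      by (simp add: M.emeasure_eq_measure)
    with \<delta>(1) show False by simp
  qed
  then obtain U where U: "open U" "E \<subseteq> U" "measure M U < measure M E + \<delta> / 2" by blast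
  obtain k :: "complex \<Rightarrow> complex" where k: "continuous_on UNIV k"
      "\<And>x. k x \<in> closed_segment 1 0" "\<And>x. x \<in> K \<Longrightarrow> k x = 1" "\<And>x. x \<in> - U \<Longrightarrow> k x = 0"
    using Urysohn[of K "- U" "1::complex" 0] K U by blast
  have k_cont: "continuous_on (sphere 0 1) k"
    using k(1) by (rule continuous_on_subset) simp
  have k_seg: "norm (k x) \<le> 1" "norm (1 - k x) \<le> 1" for x
  proof -
    obtain t where t: "k x = of_real (1 - t)" "0 \<le> t" "t \<le> 1"
      using k(2)[of x] by (auto simp: closed_segment_def scaleR_conv_of_real)
    from t show "norm (k x) \<le> 1" by (simp only: norm_of_real)
    have "norm (of_real t :: complex) \<le> 1" using t by (simp only: norm_of_real)
    then show "norm (1 - k x) \<le> 1" using t(1) by simp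
  qed
  define B where "B = (U - K) \<inter> sphere 0 1"
  have B: "B \<in> sets circle_measure"
    unfolding B_def sets_circle_measure sets_restrict_space using K U
    by (intro image_eqI[of _ _ "U - K"]) auto
  have "measure circle_measure B = measure M (U - K)"
    unfolding B_def using K U by (intro meas[symmetric]) auto
  also have "\<dots> = measure M U - measure M K"
    using K U by (intro M.finite_measure_Diff) (auto simp: sets_M)
  also have "\<dots> < \<delta>" using K U by simp
  finally have "\<alpha> (indicator B) < \<epsilon>" using \<delta>(2) B by blast
  moreover have "\<alpha> (\<lambda>z. indicator E z - k z) \<le> \<alpha> (indicator B)"
  proof (intro mono Linf_diff Linf_indicator assms B Linf_continuous k_cont AE_I2)
    fix z assume "z \<in> space circle_measure"
    then show "norm (indicator E z - k z) \<le> norm (indicator B z :: complex)"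
      using k(3,4)[of z] k_seg[of z] K(2) U(2) by (auto simp: B_def split: split_indicator)
  qed
  ultimately show "\<exists>g\<in>Linf. approx g \<and> \<alpha> (\<lambda>z. indicator E z - g z) < \<epsilon>"
    using k_cont by (intro bexI[of _ k]) (auto intro: approx_continuous Linf_continuous)
qed

lemma approx_simple:
  assumes "simple_function circle_measure f"
  shows "approx f"
proof -
  define g where "g = (\<lambda>z. \<Sum>y\<in>f ` sphere 0 1. y * indicator (f -` {y} \<inter> sphere 0 1) z)"
  have f: "f z = g z" if "norm z = 1" for z
  proof -
    have "f z = (\<Sum>y\<in>f ` sphere 0 1. indicator (f -` {y} \<inter> sphere 0 1) z *\<^sub>R y)"
      unfolding space_circle_measure[symmetric]
      by (rule simple_function_indicator_representation_banach[OF assms]) (simp add: that)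
    also have "\<dots> = g z"
      unfolding g_def by (intro sum.cong refl) (simp split: split_indicator)
    finally show ?thesis .
  qed
  have sets: "f -` {y} \<inter> sphere 0 1 \<in> sets circle_measure" for y
    using simple_functionD(2)[OF assms, of "{y}"] by simp
  have "approx g"
    unfolding g_def using simple_functionD(1)[OF assms]
    by (intro approx_sum Linf_scale Linf_indicator approx_scale approx_indicator sets) simp
  moreover have "g \<in> Linf"
    unfolding g_def by (intro Linf_sum Linf_scale Linf_indicator sets)
  ultimately show ?thesis
    using f by (intro approxI_uniform[OF Linf_simple[OF assms]] bexI[of _ g]) auto
qed

lemma approx_Linf:
  assumes "f \<in> Linf" shows "approx f"
proof -
  obtain C where C: "AE z in circle_measure. norm (f z) \<le> C" using assms by (auto simp: Linf_def)
  note [measurable] = Linf_measurable[OF assms]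
  \<comment> \<open>Changing \<open>f\<close> on a null set makes it bounded everywhere, so that
    rounding its real and imaginary parts leaves finitely many values.\<close>
  define g where "g = (\<lambda>z. if norm (f z) \<le> C then f z else 0)"
  have gm [measurable]: "g \<in> borel_measurable circle_measure" unfolding g_def by measurable
  have g_le: "norm (g z) \<le> max C 0" for z by (auto simp: g_def)
  then have g: "g \<in> Linf" by (intro LinfI_bounded gm)
  have "approx g"
  proof (rule approxI_uniform[OF g])
    fix \<epsilon> :: real assume "0 < \<epsilon>"
    then obtain n where n: "inverse (real (Suc n)) < \<epsilon> / 2"
      using reals_Archimedean[of "\<epsilon> / 2"] by auto
    define s where "s = (\<lambda>z. of_real (grid n (Re (g z))) + \<i> * of_real (grid n (Im (g z))))"
    have "simple_function circle_measure s"
    proof (rule simple_function_borel_measurable)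
      show "s \<in> borel_measurable circle_measure"
        unfolding s_def by measurable
      have "finite ((\<lambda>(x, y). complex_of_real x + \<i> * complex_of_real y) `
          ((\<lambda>z. grid n (Re (g z))) ` UNIV \<times> (\<lambda>z. grid n (Im (g z))) ` UNIV))"
        using order_trans[OF abs_Re_le_cmod g_le] order_trans[OF abs_Im_le_cmod g_le]
        by (intro finite_imageI finite_cartesian_product finite_grid[of _ _ "max C 0"])
      then show "finite (s ` space circle_measure)"
        by (rule finite_subset[rotated]) (auto simp: s_def)
    qed
    moreover have "norm (g z - s z) \<le> \<epsilon>" for z
    proof -
      have "norm (g z - s z) \<le> \<bar>Re (g z - s z)\<bar> + \<bar>Im (g z - s z)\<bar>" by (rule cmod_le)
      also have "\<dots> \<le> \<epsilon>"
        using grid_error[of "Re (g z)" n] grid_error[of "Im (g z)" n] n by (simp add: s_def)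
      finally show ?thesis .
    qed
    ultimately show "\<exists>s\<in>Linf. approx s \<and> (\<forall>z. norm z = 1 \<longrightarrow> norm (g z - s z) \<le> \<epsilon>)"
      by (intro bexI[of _ s]) (auto intro: approx_simple Linf_simple)
  qed
  moreover have "\<alpha> (\<lambda>z. f z - g z) \<le> \<alpha> (\<lambda>z. 0)"
  proof (intro mono Linf_diff assms g Linf_const)
    show "AE z in circle_measure. norm (f z - g z) \<le> norm (0::complex)"
      using C by eventually_elim (simp add: g_def)
  qed
  moreover have "\<alpha> (\<lambda>z. 0) = 0"
    using scale[OF Linf_const, of 0 0] by simp
  ultimately show ?thesis
    using g by (intro approxI[OF assms]) fastforce
qed

end

section \<open>Fejer means\<close>

text \<open>A geometric sum whose ratio \<zeta> satisfies \<open>\<zeta> ^ M = 1\<close>. The bound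
  on \<open>j\<close> excludes aliasing: 0 is the only multiple of \<open>M\<close> in that range,
  so otherwise \<open>\<zeta> \<noteq> 1\<close>.\<close>

lemma sum_roots_of_unity_powi:
  assumes "\<bar>j\<bar> < int M"
  shows "(\<Sum>k<M. cis (2 * pi * real k / real M) powi j) = (if j = 0 then of_nat M else 0)"
proof (cases "j = 0")
  case False
  define \<zeta> where "\<zeta> = cis (2 * pi * of_int j / real M)"
  have M: "0 < M" using assms by auto
  have "\<zeta> \<noteq> 1"
  proof
    assume "\<zeta> = 1"
    then have "cos (2 * pi * of_int j / real M) = 1"
      unfolding \<zeta>_def by (metis cis.sel(1) one_complex.sel(1))
    then obtain n :: int where "2 * pi * of_int j / real M = of_int n * 2 * pi"
      unfolding cos_one_2pi_int by auto
    then have "real_of_int j = of_int (n * int M)"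
      using M by (simp add: field_simps)
    then have "j = n * int M" by (simp only: of_int_eq_iff)
    with assms False M show False
      by (cases "n = 0") (auto simp: abs_mult)
  qed
  have "\<zeta> ^ M = cis (2 * pi * of_int j)"
    using M by (simp add: \<zeta>_def Complex.DeMoivre)
  then have "\<zeta> ^ M = 1" by simp
  have "(\<Sum>k<M. cis (2 * pi * real k / real M) powi j) = (\<Sum>k<M. \<zeta> ^ k)"
    by (intro sum.cong refl) (simp add: \<zeta>_def cis_power_int Complex.DeMoivre mult_ac)
  also have "\<dots> = 0"
    using \<open>\<zeta> \<noteq> 1\<close> \<open>\<zeta> ^ M = 1\<close> by (simp add: geometric_sum)
  finally show ?thesis using False by simp
qed simp

text \<open>These are the Fourier coefficients \<open>max 0 (1 - \<bar>n\<bar> / N)\<close> of the Fejer kernel.\<close>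

definition fejer :: "nat \<Rightarrow> int \<Rightarrow> real" where
  "fejer N n = (\<Sum>a<N. of_bool (n \<le> int a \<and> int a < int N + n)) / real N"

lemma fejer_0: "0 < N \<Longrightarrow> fejer N 0 = 1"
  by (simp add: fejer_def)

lemma fejer_eq_0: "int N \<le> \<bar>n\<bar> \<Longrightarrow> fejer N n = 0"
  unfolding fejer_def by (intro divide_eq_0_iff[THEN iffD2] disjI1 sum.neutral) auto

lemma fejer_nonneg: "0 \<le> fejer N n"
  unfolding fejer_def by (intro divide_nonneg_nonneg sum_nonneg) auto

lemma fejer_le_1: "fejer N n \<le> 1"
proof -
  have "(\<Sum>a<N. of_bool (n \<le> int a \<and> int a < int N + n)) \<le> (\<Sum>a<N. 1 :: real)"
    by (intro sum_mono) simp
  then show ?thesis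
    by (cases "N = 0") (simp_all add: fejer_def)
qed

text \<open>The indices \<open>a\<close> that are not counted lie below \<open>n\<close> or from
  \<open>N + n\<close> on. Depending on the sign of \<open>n\<close> at least one of these segments
  is empty, and the other has at most as many elements as the modulus of \<open>n\<close>.\<close>

lemma one_minus_fejer_le:
  assumes "0 < N"
  shows "1 - fejer N n \<le> \<bar>of_int n\<bar> / real N"
proof -
  have "real N - (\<Sum>a<N. of_bool (n \<le> int a \<and> int a < int N + n)) =
      (\<Sum>a<N. 1 - of_bool (n \<le> int a \<and> int a < int N + n))"
    by (simp only: sum_subtractf) simp
  also have "\<dots> = (\<Sum>a<N. if a \<in> {a. \<not> (n \<le> int a \<and> int a < int N + n)} then 1 else 0)"
    by (intro sum.cong) auto
  also have "\<dots> = real (card ({..<N} \<inter> {a. \<not> (n \<le> int a \<and> int a < int N + n)}))"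
    by (subst sum.inter_restrict[symmetric]) auto
  also have "card ({..<N} \<inter> {a. \<not> (n \<le> int a \<and> int a < int N + n)}) \<le>
      card ({..<nat n} \<union> {nat (int N + n)..<N})"
    by (intro card_mono) auto
  also have "\<dots> \<le> nat n + (N - nat (int N + n))"
    using card_Un_le[of "{..<nat n}" "{nat (int N + n)..<N}"] by simp
  also have "real (nat n + (N - nat (int N + n))) \<le> \<bar>of_int n\<bar>"
    by linarith
  finally have "real N - (\<Sum>a<N. of_bool (n \<le> int a \<and> int a < int N + n)) \<le> \<bar>of_int n\<bar>"
    by simp
  then have "(real N - (\<Sum>a<N. of_bool (n \<le> int a \<and> int a < int N + n))) / real N \<le> \<bar>of_int n\<bar> / real N"
    by (rule divide_right_mono) simp
  with assms show ?thesis
    by (simp add: fejer_def diff_divide_distrib)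
qed

text \<open>For fixed \<open>a\<close> the only candidate is b = a - n, and the condition in
  \<open>fejer\<close> says that it is in range. So \<open>fejer\<close> counts the pairs that give
  frequency \<open>n\<close> when the squared modulus of the sum of the first \<open>N\<close>
  powers is expanded.\<close>

lemma sum_sum_fejer:
  "(\<Sum>a<N. \<Sum>b<N. if int a - int b - n = 0 then 1 else 0) = real N * fejer N n"
proof -
  have "(\<Sum>b<N. if int a - int b - n = 0 then 1 else 0) =
      (of_bool (n \<le> int a \<and> int a < int N + n) :: real)" for a
  proof -
    have "(\<Sum>b<N. if int a - int b - n = 0 then 1 else 0) =
        (\<Sum>b<N. if b = nat (int a - n) then of_bool (n \<le> int a) else (0 :: real))"
      by (intro sum.cong refl) auto
    also have "\<dots> = of_bool (n \<le> int a \<and> int a < int N + n)"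
      by (auto simp: nat_less_iff)
    finally show ?thesis .
  qed
  then show ?thesis by (simp add: fejer_def)
qed

text \<open>The kernel is sampled at the \<open>M\<close>-th roots of unity: for \<open>M\<close> large compared to the degree
  this makes the convolution with a trigonometric polynomial a finite convex combination of
  rotations, so that no integral of translates is needed.\<close>

lemma fejer_convex_combination:
  assumes "finite S" "0 < N"
  shows "\<exists>(M :: nat) (W :: nat \<Rightarrow> real) w. (\<forall>k. 0 \<le> W k) \<and> (\<Sum>k<M. W k) = 1 \<and> (\<forall>k. norm (w k) = 1) \<and>
    (\<forall>c z. (\<Sum>k<M. of_real (W k) * trig S c (cnj (w k) * z)) =
      trig S (\<lambda>n. of_real (fejer N n) * c n) z)"
proof -
  \<comment> \<open>\<open>M\<close> exceeds the modulus of every a - b - n with a, b < N and n in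
    \<open>S\<close>, so these exponents do not alias; the sum over \<open>S\<close> serves as a
    bound for the maximum.\<close>
  define M where "M = N + (\<Sum>n\<in>S. nat \<bar>n\<bar>) + 1"
  define w where "w = (\<lambda>k. cis (2 * pi * real k / real M))"
  \<comment> \<open>The Fejer kernel at \<open>w k\<close>, divided by \<open>M\<close>; as a
    squared modulus it is nonnegative.\<close>
  define W where "W = (\<lambda>k. (norm (\<Sum>a<N. w k ^ a))\<^sup>2 / (real M * real N))"
  have M: "0 < M" by (simp add: M_def)
  have w0: "w k \<noteq> 0" for k by (simp add: w_def)
  have W: "of_real (W k) = (\<Sum>a<N. \<Sum>b<N. w k powi (int a - int b)) / (of_nat M * of_nat N)" for k
  proof -
    have "complex_of_real ((norm (\<Sum>a<N. w k ^ a))\<^sup>2) = (\<Sum>a<N. w k ^ a) * (\<Sum>b<N. cnj (w k) ^ b)"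
      by (simp only: complex_norm_square cnj_sum complex_cnj_power)
    also have "cnj (w k) = inverse (w k)"
      by (simp add: w_def cis_cnj cis_inverse)
    also have "(\<Sum>a<N. w k ^ a) * (\<Sum>b<N. inverse (w k) ^ b) =
        (\<Sum>a<N. \<Sum>b<N. w k powi (int a - int b))"
      using w0[of k] by (simp add: sum_product power_int_diff divide_inverse power_inverse)
    finally show ?thesis by (simp add: W_def)
  qed
  \<comment> \<open>Sampling at the roots of unity reproduces the kernel's coefficient exactly. The
    case \<open>n = 0\<close> gives the weights total mass 1.\<close>
  have key: "(\<Sum>k<M. of_real (W k) * w k powi (- n)) = complex_of_real (fejer N n)"
    if n: "N + nat \<bar>n\<bar> < M + 1" for n
  proof -
    have "(\<Sum>k<M. of_real (W k) * w k powi (- n)) =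
        (\<Sum>k<M. \<Sum>a<N. \<Sum>b<N. w k powi (int a - int b - n)) / (of_nat M * of_nat N)"
      using w0 by (simp add: W power_int_diff power_int_minus divide_inverse
          sum_distrib_left sum_distrib_right mult_ac)
    also have "(\<Sum>k<M. \<Sum>a<N. \<Sum>b<N. w k powi (int a - int b - n)) =
        (\<Sum>a<N. \<Sum>k<M. \<Sum>b<N. w k powi (int a - int b - n))"
      by (rule sum.swap)
    also have "\<dots> = (\<Sum>a<N. \<Sum>b<N. \<Sum>k<M. w k powi (int a - int b - n))"
      by (rule sum.cong[OF refl]) (rule sum.swap)
    also have "\<dots> = (\<Sum>a<N. \<Sum>b<N. if int a - int b - n = 0 then of_nat M else 0)"
    proof (intro sum.cong refl)
      fix a b assume "a \<in> {..<N}" "b \<in> {..<N}"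
      then have "\<bar>int a - int b - n\<bar> < int M" using n by auto
      then show "(\<Sum>k<M. w k powi (int a - int b - n)) =
          (if int a - int b - n = 0 then of_nat M else 0)"
        unfolding w_def by (rule sum_roots_of_unity_powi)
    qed
    also have "\<dots> = of_nat M * of_real (\<Sum>a<N. \<Sum>b<N. if int a - int b - n = 0 then 1 else 0)"
      by (simp add: sum_distrib_left if_distrib cong: if_cong)
    also have "\<dots> = of_nat M * (of_nat N * of_real (fejer N n))"
      unfolding sum_sum_fejer by simp
    finally show ?thesis using M assms(2) by simp
  qed
  have "complex_of_real (\<Sum>k<M. W k) = of_real 1"
    using key[of 0] M fejer_0[OF assms(2)] by (simp add: M_def)
  then have W1: "(\<Sum>k<M. W k) = 1" by (simp only: of_real_eq_iff)
  have conv: "(\<Sum>k<M. of_real (W k) * trig S c (cnj (w k) * z)) =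
      trig S (\<lambda>n. of_real (fejer N n) * c n) z" for c z
  proof -
    have "(\<Sum>k<M. of_real (W k) * trig S c (cnj (w k) * z)) =
        (\<Sum>k<M. \<Sum>n\<in>S. of_real (W k) * w k powi (- n) * (c n * z powi n))"
      unfolding trig_def sum_distrib_left
      by (intro sum.cong refl)
        (simp add: power_int_mult_distrib power_int_minus w_def cis_cnj mult_ac
          flip: cis_inverse power_int_inverse)
    also have "\<dots> = (\<Sum>n\<in>S. (\<Sum>k<M. of_real (W k) * w k powi (- n)) * (c n * z powi n))"
      by (subst sum.swap) (simp add: sum_distrib_right)
    also have "\<dots> = (\<Sum>n\<in>S. of_real (fejer N n) * (c n * z powi n))"
    proof (intro sum.cong refl)
      fix n assume "n \<in> S"
      then have "nat \<bar>n\<bar> \<le> (\<Sum>n\<in>S. nat \<bar>n\<bar>)"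
        using assms(1) by (intro member_le_sum) auto
      then show "(\<Sum>k<M. of_real (W k) * w k powi (- n)) * (c n * z powi n) =
          of_real (fejer N n) * (c n * z powi n)"
        by (subst key) (auto simp: M_def)
    qed
    finally show ?thesis by (simp add: trig_def mult_ac)
  qed
  show ?thesis
    using W1 conv by (intro exI[of _ M] exI[of _ W] exI[of _ w]) (simp add: W_def w_def)
qed

section \<open>Solidity, contraction by Fejer means, and domination of the L1 norm\<close>

context continuous_rotationally_symmetric_norm
begin

text \<open>With \<open>u = \<bar>f\<bar> + \<i> * sqrt (\<bar>g\<bar>\<^sup>2 - \<bar>f\<bar>\<^sup>2)\<close> one has \<open>\<bar>u\<bar> = \<bar>g\<bar>\<close>, and \<open>\<bar>f\<bar>\<close> is the average of \<open>u\<close> and its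
  conjugate.\<close>

lemma mono_AE:
  assumes "f \<in> Linf" "g \<in> Linf" "AE z in circle_measure. norm (f z) \<le> norm (g z)"
  shows "\<alpha> f \<le> \<alpha> g"
proof -
  note [measurable] = assms(1,2)[THEN Linf_measurable]
  \<comment> \<open>The \<open>max\<close> guards the null set on which \<open>norm (f z)\<close>
    may exceed \<open>norm (g z)\<close>.\<close>
  define h where "h = (\<lambda>z. sqrt (max 0 ((norm (g z))\<^sup>2 - (norm (f z))\<^sup>2)))"
  define u where "u = (\<lambda>z. complex_of_real (norm (f z)) + \<i> * complex_of_real (h z))"
  define v where "v = (\<lambda>z. complex_of_real (norm (f z)) - \<i> * complex_of_real (h z))"
  have [measurable]: "h \<in> borel_measurable circle_measure" unfolding h_def by measurable
  have [measurable]: "u \<in> borel_measurable circle_measure" "v \<in> borel_measurable circle_measure"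
    unfolding u_def v_def by measurable
  have norm_uv: "norm (u z) = sqrt ((norm (f z))\<^sup>2 + (h z)\<^sup>2)" "norm (v z) = norm (u z)" for z
    by (simp_all add: u_def v_def cmod_def)
  have u_eq: "AE z in circle_measure. norm (u z) = norm (g z)"
    using assms(3)
  proof eventually_elim
    fix z assume "norm (f z) \<le> norm (g z)"
    then have "(norm (f z))\<^sup>2 \<le> (norm (g z))\<^sup>2" by (intro power_mono) auto
    then show "norm (u z) = norm (g z)" by (simp add: norm_uv h_def)
  qed
  have uv: "u \<in> Linf" "v \<in> Linf"
    using u_eq by (auto intro!: Linf_dominated[OF _ assms(2)] simp: norm_uv(2))
  have "\<alpha> k = \<alpha> g" if "k \<in> Linf" "AE z in circle_measure. norm (k z) = norm (g z)" for k
    using cong_AE[OF Linf_norm[OF that(1)] Linf_norm[OF assms(2)]] that(2)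
    by (simp add: norm_abs that(1) assms(2))
  from this[OF uv(1)] this[OF uv(2)] have "\<alpha> u = \<alpha> g" "\<alpha> v = \<alpha> g"
    using u_eq by (simp_all add: norm_uv(2))
  have "\<alpha> f = \<alpha> (\<lambda>z. complex_of_real (norm (f z)))"
    by (rule norm_abs[OF assms(1), symmetric])
  also have "\<dots> = \<alpha> (\<lambda>z. 1 / 2 * u z + 1 / 2 * v z)"
    by (simp add: u_def v_def field_simps)
  also have "\<dots> \<le> \<alpha> (\<lambda>z. 1 / 2 * u z) + \<alpha> (\<lambda>z. 1 / 2 * v z)"
    by (intro triangle Linf_scale uv)
  also have "\<dots> = \<alpha> g"
    using scale[OF uv(1), of "1 / 2"] scale[OF uv(2), of "1 / 2"] \<open>\<alpha> u = \<alpha> g\<close> \<open>\<alpha> v = \<alpha> g\<close> by simp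
  finally show ?thesis .
qed

sublocale solid: circle_norm \<alpha>
proof
  fix \<epsilon> :: real assume "0 < \<epsilon>"
  then obtain \<delta> where \<delta>: "0 < \<delta>" "\<And>E. E \<in> sets circle_measure \<Longrightarrow> 0 < measure circle_measure E \<Longrightarrow>
      measure circle_measure E < \<delta> \<Longrightarrow> \<alpha> (indicator E) < \<epsilon>"
    using continuity by blast
  have "\<alpha> (indicator E) < \<epsilon>" if E: "E \<in> sets circle_measure" "measure circle_measure E < \<delta>" for E
  \<comment> \<open>The continuity axiom speaks of sets of positive measure; for a null set
    \<open>eq_0_iff\<close> gives norm 0.\<close>
  proof (cases "measure circle_measure E = 0")
    case True
    then have "E \<in> null_sets circle_measure"
      using E(1) by (simp add: null_sets_def circle.emeasure_eq_measure)
    then have "AE z in circle_measure. indicator E z = (0 :: complex)"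
      using AE_not_in[of E circle_measure] by (auto elim: eventually_mono)
    then show ?thesis
      using eq_0_iff[OF Linf_indicator[OF E(1)]] \<open>0 < \<epsilon>\<close> by simp
  next
    case False
    with \<delta> E show ?thesis by (simp add: zero_less_measure_iff)
  qed
  with \<delta>(1) show "\<exists>\<delta>>0. \<forall>E\<in>sets circle_measure.
      measure circle_measure E < \<delta> \<longrightarrow> \<alpha> (indicator E) < \<epsilon>" by blast
qed (fact nonneg triangle scale mono_AE)+

text \<open>The left side is the norm of a convex combination of rotations of
  \<open>trig S c\<close>, each of the same norm, so the triangle inequality suffices.\<close>

lemma fejer_contraction:
  assumes "finite S" "0 < N"
  shows "\<alpha> (trig S (\<lambda>n. of_real (fejer N n) * c n)) \<le> \<alpha> (trig S c)"
proof -
  obtain M :: nat and W :: "nat \<Rightarrow> real" and w where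
    W: "\<forall>k. 0 \<le> W k" "(\<Sum>k<M. W k) = 1" "\<forall>k. norm (w k) = 1"
    "\<forall>c z. (\<Sum>k<M. of_real (W k) * trig S c (cnj (w k) * z)) =
      trig S (\<lambda>n. of_real (fejer N n) * c n) z"
    using fejer_convex_combination[OF assms] by (elim exE conjE)
  have rot: "(\<lambda>z. trig S c (cnj (w k) * z)) \<in> Linf" for k
  proof -
    have "(\<lambda>z. trig S c (cnj (w k) * z)) = trig S (\<lambda>n. c n * cnj (w k) powi n)"
      by (simp add: trig_def power_int_mult_distrib mult_ac fun_eq_iff)
    then show ?thesis by (simp add: Linf_trig)
  qed
  have "\<alpha> (trig S (\<lambda>n. of_real (fejer N n) * c n)) =
      \<alpha> (\<lambda>z. \<Sum>k<M. of_real (W k) * trig S c (cnj (w k) * z))"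
    using W(4) by simp
  also have "\<dots> \<le> (\<Sum>k<M. \<alpha> (\<lambda>z. of_real (W k) * trig S c (cnj (w k) * z)))"
    by (intro solid.sum Linf_scale rot) simp
  also have "\<dots> = (\<Sum>k<M. W k * \<alpha> (trig S c))"
    using W(1) by (simp add: scale[OF rot] rotation[OF Linf_trig W(3)[rule_format]])
  also have "\<dots> = \<alpha> (trig S c)"
    using W(2) by (simp flip: sum_distrib_right)
  finally show ?thesis .
qed

lemma norm_integral_trig_le:
  assumes "finite S"
  shows "norm (\<integral>z. trig S c z \<partial>circle_measure) \<le> \<alpha> (trig S c)"
proof -
  define k where "k = (if 0 \<in> S then c 0 else 0)"
  have "(\<integral>z. trig S c z \<partial>circle_measure) = k"
    using fourier_coeff_trig[OF assms, of c 0] by (simp add: fourier_coeff_def k_def)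
  moreover have "norm k = \<alpha> (\<lambda>z. k * 1)"
    using scale[OF Linf_const, of k 1] norm_one by simp
  moreover have "trig S (\<lambda>n. of_real (fejer 1 n) * c n) = (\<lambda>z. k * 1)"
  proof
    fix z
    \<comment> \<open>For \<open>N = 1\<close> the only index is \<open>a = 0\<close>, and the
      condition in \<open>fejer\<close> reduces to \<open>n = 0\<close>.\<close>
    have "trig S (\<lambda>n. of_real (fejer 1 n) * c n) z = (\<Sum>n\<in>S. if n = 0 then c 0 else 0)"
      unfolding trig_def by (intro sum.cong refl) (auto simp: fejer_def)
    then show "trig S (\<lambda>n. of_real (fejer 1 n) * c n) z = k * 1"
      using assms by (simp add: k_def)
  qed
  ultimately show ?thesis
    using fejer_contraction[OF assms, of 1 c] by simp
qed

text \<open>Makes the density theorem available for both norms simultaneously, before either is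
  known to control the other; \<open>L1_le\<close> depends on this.\<close>

lemma circle_norm_plus_L1: "circle_norm (\<lambda>f. \<alpha> f + (\<integral>z. norm (f z) \<partial>circle_measure))"
proof
  fix f g :: "complex \<Rightarrow> complex" assume fg: "f \<in> Linf" "g \<in> Linf"
  note int = fg[THEN Linf_integrable, THEN integrable_norm]
  have "(\<integral>z. norm (f z + g z) \<partial>circle_measure) \<le> (\<integral>z. norm (f z) + norm (g z) \<partial>circle_measure)"
    using int by (intro integral_mono integrable_norm Linf_integrable Linf_add fg
        Bochner_Integration.integrable_add norm_triangle_ineq)
  then show "\<alpha> (\<lambda>z. f z + g z) + (\<integral>z. norm (f z + g z) \<partial>circle_measure) \<le>
      \<alpha> f + (\<integral>z. norm (f z) \<partial>circle_measure) + (\<alpha> g + (\<integral>z. norm (g z) \<partial>circle_measure))"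
    using triangle[OF fg] int by simp
  assume "AE z in circle_measure. norm (f z) \<le> norm (g z)"
  then show "\<alpha> f + (\<integral>z. norm (f z) \<partial>circle_measure) \<le> \<alpha> g + (\<integral>z. norm (g z) \<partial>circle_measure)"
    using int by (intro add_mono solid.mono fg integral_mono_AE)
next
  fix \<epsilon> :: real assume "0 < \<epsilon>"
  then obtain \<delta> where \<delta>: "0 < \<delta>" "\<And>E. E \<in> sets circle_measure \<Longrightarrow>
      measure circle_measure E < \<delta> \<Longrightarrow> \<alpha> (indicator E) < \<epsilon> / 2"
    using solid.continuity[of "\<epsilon> / 2"] by auto
  have "\<alpha> (indicator E) + (\<integral>z. norm (indicator E z :: complex) \<partial>circle_measure) < \<epsilon>"
    if "E \<in> sets circle_measure" "measure circle_measure E < min \<delta> (\<epsilon> / 2)" for E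
  proof -
    have "(\<integral>z. norm (indicator E z :: complex) \<partial>circle_measure) = (\<integral>z. indicator E z \<partial>circle_measure)"
      by (intro Bochner_Integration.integral_cong) (auto split: split_indicator)
    also have "\<dots> = measure circle_measure E"
      using that(1) sets.sets_into_space[OF that(1)] by (simp add: Int_absorb2)
    finally show ?thesis using \<delta>(2)[OF that(1)] that(2) by simp
  qed
  with \<delta>(1) \<open>0 < \<epsilon>\<close> show "\<exists>\<delta>>0. \<forall>E\<in>sets circle_measure. measure circle_measure E < \<delta> \<longrightarrow>
      \<alpha> (indicator E) + (\<integral>z. norm (indicator E z :: complex) \<partial>circle_measure) < \<epsilon>"
    by (intro exI[of _ "min \<delta> (\<epsilon> / 2)"]) auto
qed (auto simp: nonneg scale norm_mult distrib_left)

text \<open>The L1 norm of \<open>f\<close> is the integral of its modulus \<open>g\<close>, which a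
  polynomial \<open>p\<close> approximates. The L1 part of the error controls the change of the
  integral, the \<alpha> part that of the norm, and \<open>norm_integral_trig_le\<close> compares
  the two for \<open>p\<close>.\<close>

lemma L1_le:
  assumes "f \<in> Linf"
  shows "(\<integral>z. norm (f z) \<partial>circle_measure) \<le> \<alpha> f"
proof (rule field_le_epsilon)
  fix \<epsilon> :: real assume "0 < \<epsilon>"
  interpret plus: circle_norm "\<lambda>f. \<alpha> f + (\<integral>z. norm (f z) \<partial>circle_measure)"
    by (rule circle_norm_plus_L1)
  define g where "g = (\<lambda>z. complex_of_real (norm (f z)))"
  have g: "g \<in> Linf" unfolding g_def by (rule Linf_norm[OF assms])
  obtain S c where S: "finite S"
    and less: "\<alpha> (\<lambda>z. g z - trig S c z) + (\<integral>z. norm (g z - trig S c z) \<partial>circle_measure) < \<epsilon>"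
    using plus.approx_Linf[OF g] \<open>0 < \<epsilon>\<close> unfolding plus.approx_def by blast
  define p where "p = trig S c"
  have p: "p \<in> Linf" unfolding p_def by (rule Linf_trig)
  note gp = Linf_diff[OF g p, THEN Linf_integrable]
  have "(\<integral>z. g z \<partial>circle_measure) = of_real (\<integral>z. norm (f z) \<partial>circle_measure)"
    unfolding g_def by (rule integral_complex_of_real)
  then have "(\<integral>z. norm (f z) \<partial>circle_measure) = norm (\<integral>z. g z \<partial>circle_measure)"
    by simp
  also have "(\<integral>z. g z \<partial>circle_measure) = (\<integral>z. p z \<partial>circle_measure) + (\<integral>z. g z - p z \<partial>circle_measure)"
    using g p by (simp add: Linf_integrable)
  also have "norm \<dots> \<le> norm (\<integral>z. p z \<partial>circle_measure) + (\<integral>z. norm (g z - p z) \<partial>circle_measure)"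
    by (intro order_trans[OF norm_triangle_ineq] add_left_mono integral_norm_bound)
  also have "norm (\<integral>z. p z \<partial>circle_measure) \<le> \<alpha> p"
    unfolding p_def by (rule norm_integral_trig_le[OF S])
  also have "\<alpha> p \<le> \<alpha> g + \<alpha> (\<lambda>z. g z - p z)"
    using triangle[OF g Linf_diff[OF p g]] solid.diff_commute[OF g p] by simp
  also have "\<alpha> g = \<alpha> f"
    unfolding g_def by (rule norm_abs[OF assms])
  finally show "(\<integral>z. norm (f z) \<partial>circle_measure) \<le> \<alpha> f + \<epsilon>"
    using less by (simp add: p_def)
qed

end

section \<open>The extended norm and Hardy spaces\<close>

context continuous_rotationally_symmetric_norm
begin

lemma ext_norm_upper:
  assumes "simple_function circle_measure s" "AE z in circle_measure. norm (s z) \<le> norm (f z)"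
  shows "ennreal (\<alpha> s) \<le> ext_norm \<alpha> f"
  unfolding ext_norm_def using assms by (intro SUP_upper) simp

lemma ext_norm_mono:
  assumes "AE z in circle_measure. norm (f z) \<le> norm (g z)"
  shows "ext_norm \<alpha> f \<le> ext_norm \<alpha> g"
  unfolding ext_norm_def[of _ f]
proof (rule SUP_least, clarify)
  fix s :: "complex \<Rightarrow> complex"
  assume s: "simple_function circle_measure s" and "AE z in circle_measure. norm (s z) \<le> norm (f z)"
  from this(2) assms have "AE z in circle_measure. norm (s z) \<le> norm (g z)"
    by eventually_elim simp
  with s show "ennreal (\<alpha> s) \<le> ext_norm \<alpha> g" by (rule ext_norm_upper)
qed

lemma ext_norm_le:
  assumes "f \<in> Linf"
  shows "ext_norm \<alpha> f \<le> ennreal (\<alpha> f)"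
  unfolding ext_norm_def
  using assms by (intro SUP_least ennreal_leI solid.mono) (auto intro: Linf_simple)

text \<open>Rounding the modulus of \<open>f\<close> down to a grid gives a simple minorant
  \<open>s\<close> with a uniformly small error \<open>d\<close>, and a function bounded by
  \<epsilon> has norm at most \<epsilon> by solidity and normalization.\<close>

lemma le_ext_norm:
  assumes "f \<in> Linf"
  shows "ennreal (\<alpha> f) \<le> ext_norm \<alpha> f"
proof (rule ennreal_le_epsilon)
  fix \<epsilon> :: real assume "0 < \<epsilon>"
  then obtain n where n: "inverse (real (Suc n)) < \<epsilon>"
    using reals_Archimedean by blast
  note [measurable] = Linf_measurable[OF assms]
  obtain C where C: "AE z in circle_measure. norm (f z) \<le> C" using assms by (auto simp: Linf_def)
  define h where "h = (\<lambda>z. if norm (f z) \<le> C then norm (f z) else 0)"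
  have h: "0 \<le> h z" "h z \<le> norm (f z)" "\<bar>h z\<bar> \<le> \<bar>C\<bar>" for z by (auto simp: h_def)
  have [measurable]: "h \<in> borel_measurable circle_measure" unfolding h_def by measurable
  define s where "s = (\<lambda>z. complex_of_real (grid n (h z)))"
  have s_meas: "s \<in> borel_measurable circle_measure" unfolding s_def by measurable
  have s: "simple_function circle_measure s"
  proof (rule simple_function_borel_measurable[OF s_meas])
    have "finite ((\<lambda>z. grid n (h z)) ` space circle_measure)"
      using h(3) by (rule finite_grid)
    then have "finite (complex_of_real ` (\<lambda>z. grid n (h z)) ` space circle_measure)"
      by (rule finite_imageI)
    then show "finite (s ` space circle_measure)"
      by (simp only: image_image s_def)
  qed
  have s_le: "norm (s z) \<le> norm (f z)" for z
    using order_trans[OF grid_le h(2), of n z] grid_nonneg[OF h(1), of n z] by (simp add: s_def)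
  define d where "d = (\<lambda>z. complex_of_real (h z) - s z)"
  have hLinf: "(\<lambda>z. complex_of_real (h z)) \<in> Linf"
    using h by (intro Linf_dominated[OF _ assms]) auto
  have dLinf: "d \<in> Linf"
    unfolding d_def by (intro Linf_diff hLinf Linf_simple[OF s])
  have d_le: "norm (d z) \<le> \<epsilon>" for z
    using grid_error[of "h z" n] n
    by (simp add: d_def s_def flip: of_real_diff)
  have "\<alpha> f \<le> \<alpha> (\<lambda>z. s z + d z)"
  proof (intro solid.mono assms Linf_add Linf_simple[OF s] dLinf)
    show "AE z in circle_measure. norm (f z) \<le> norm (s z + d z)"
      using C by eventually_elim (simp add: d_def h_def)
  qed
  also have "\<dots> \<le> \<alpha> s + \<alpha> d"
    by (intro triangle Linf_simple[OF s] dLinf)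
  also have "\<alpha> d \<le> \<epsilon>"
    using solid.le_const[OF dLinf d_le] \<open>0 < \<epsilon>\<close> norm_one by simp
  finally have "ennreal (\<alpha> f) \<le> ennreal (\<alpha> s + \<epsilon>)"
    by (simp add: ennreal_leI)
  also have "\<dots> = ennreal (\<alpha> s) + ennreal \<epsilon>"
    using nonneg[OF Linf_simple[OF s]] \<open>0 < \<epsilon>\<close> by simp
  also have "ennreal (\<alpha> s) \<le> ext_norm \<alpha> f"
    using s s_le by (intro ext_norm_upper) auto
  finally show "ennreal (\<alpha> f) \<le> ext_norm \<alpha> f + ennreal \<epsilon>"
    by (simp add: add_right_mono)
qed

text \<open>A simple minorant \<open>s\<close> of the sum is dominated by the sum of the moduli of
  \<open>f\<close> and \<open>g\<close>, each truncated at the modulus of \<open>s\<close>. The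
  truncations are bounded, so the triangle inequality of \<alpha> applies; they need not be simple,
  and \<open>le_ext_norm\<close> bridges that gap.\<close>

lemma ext_norm_triangle:
  assumes [measurable]: "f \<in> borel_measurable circle_measure" "g \<in> borel_measurable circle_measure"
  shows "ext_norm \<alpha> (\<lambda>z. f z + g z) \<le> ext_norm \<alpha> f + ext_norm \<alpha> g"
  unfolding ext_norm_def[of _ "\<lambda>z. f z + g z"]
proof (rule SUP_least, safe)
  fix s :: "complex \<Rightarrow> complex"
  assume s: "simple_function circle_measure s"
    and le: "AE z in circle_measure. norm (s z) \<le> norm (f z + g z)"
  note [measurable] = borel_measurable_simple_function[OF s]
  define t where "t = (\<lambda>u z. complex_of_real (min (norm (u z :: complex)) (norm (s z))))"
  have tm: "t u \<in> borel_measurable circle_measure" if [measurable]: "u \<in> borel_measurable circle_measure" for u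
    unfolding t_def by measurable
  have t: "t u \<in> Linf" if "u \<in> borel_measurable circle_measure" for u
    by (rule Linf_dominated[OF tm[OF that] Linf_simple[OF s]]) (simp add: t_def)
  have ext_t: "ennreal (\<alpha> (t u)) \<le> ext_norm \<alpha> u" if "u \<in> borel_measurable circle_measure" for u
    by (rule order_trans[OF le_ext_norm[OF t[OF that]] ext_norm_mono]) (simp add: t_def)
  have "\<alpha> s \<le> \<alpha> (\<lambda>z. t f z + t g z)"
  proof (intro solid.mono Linf_simple[OF s] Linf_add t assms)
    show "AE z in circle_measure. norm (s z) \<le> norm (t f z + t g z)"
      using le
    proof eventually_elim
      fix z assume "norm (s z) \<le> norm (f z + g z)"
      then have "norm (s z) \<le> norm (f z) + norm (g z)"
        using norm_triangle_ineq order_trans by blast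
      then have "norm (s z) \<le> min (norm (f z)) (norm (s z)) + min (norm (g z)) (norm (s z))"
        by (auto simp: min_def)
      then show "norm (s z) \<le> norm (t f z + t g z)"
        unfolding t_def of_real_add[symmetric] norm_of_real by simp
    qed
  qed
  also have "\<dots> \<le> \<alpha> (t f) + \<alpha> (t g)"
    by (intro triangle t assms)
  finally have "ennreal (\<alpha> s) \<le> ennreal (\<alpha> (t f)) + ennreal (\<alpha> (t g))"
    using nonneg[OF t[OF assms(1)]] nonneg[OF t[OF assms(2)]] by (simp add: ennreal_leI flip: ennreal_plus)
  also have "\<dots> \<le> ext_norm \<alpha> f + ext_norm \<alpha> g"
    by (intro add_mono ext_t assms)
  finally show "ennreal (\<alpha> s) \<le> ext_norm \<alpha> f + ext_norm \<alpha> g" .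
qed

lemma ext_norm_diff_triangle:
  assumes "f \<in> borel_measurable circle_measure" "g \<in> borel_measurable circle_measure"
    "h \<in> borel_measurable circle_measure"
  shows "ext_norm \<alpha> (\<lambda>z. f z - h z) \<le> ext_norm \<alpha> (\<lambda>z. f z - g z) + ext_norm \<alpha> (\<lambda>z. g z - h z)"
  using ext_norm_triangle[of "\<lambda>z. f z - g z" "\<lambda>z. g z - h z"] assms by simp

lemma ext_norm_diff_commute: "ext_norm \<alpha> (\<lambda>z. f z - g z) = ext_norm \<alpha> (\<lambda>z. g z - f z)"
  unfolding ext_norm_def by (simp only: norm_minus_commute)

text \<open>Every finite-valued simple minorant of the integrand is the modulus of a complex simple
  function \<open>t\<close>, to which \<open>L1_le\<close> applies. Finite values make
  \<open>enn2real\<close> lossless.\<close>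

lemma nn_integral_le_ext_norm:
  "(\<integral>\<^sup>+z. ennreal (norm (f z)) \<partial>circle_measure) \<le> ext_norm \<alpha> f"
  unfolding nn_integral_def_finite
proof (rule SUP_least, safe)
  fix s assume s: "simple_function circle_measure s" "s \<le> (\<lambda>z. ennreal (norm (f z)))" "\<forall>z. s z < top"
  define t where "t = (\<lambda>z. complex_of_real (enn2real (s z)))"
  have t: "simple_function circle_measure t"
    unfolding t_def using simple_function_compose1[OF s(1), of "\<lambda>x. complex_of_real (enn2real x)"] .
  have eq: "s z = ennreal (norm (t z))" for z
    using s(3) by (simp add: t_def)
  have "integral\<^sup>S circle_measure s = (\<integral>\<^sup>+z. s z \<partial>circle_measure)"
    by (rule nn_integral_eq_simple_integral[OF s(1), symmetric])
  also have "\<dots> = ennreal (\<integral>z. norm (t z) \<partial>circle_measure)"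
    unfolding eq
    by (intro nn_integral_eq_integral integrable_norm Linf_integrable Linf_simple t) simp
  also have "\<dots> \<le> ennreal (\<alpha> t)"
    by (intro ennreal_leI L1_le Linf_simple t)
  also have "\<dots> \<le> ext_norm \<alpha> f"
  proof (intro ext_norm_upper t AE_I2)
    fix z
    have "ennreal (norm (t z)) \<le> ennreal (norm (f z))"
      using s(2) unfolding eq[symmetric] by (simp add: le_fun_def)
    then show "norm (t z) \<le> norm (f z)" by simp
  qed
  finally show "integral\<^sup>S circle_measure s \<le> ext_norm \<alpha> f" .
qed

lemma fourier_coeff_diff_le:
  assumes "F \<in> borel_measurable circle_measure" "g \<in> Linf"
    and "ext_norm \<alpha> (\<lambda>z. F z - g z) < ennreal \<epsilon>"
  shows "norm (fourier_coeff F n - fourier_coeff g n) \<le> \<epsilon>"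
proof -
  note [measurable] = assms(1) Linf_measurable[OF assms(2)]
  have powi [measurable]: "(\<lambda>z. z powi (- n)) \<in> borel_measurable circle_measure"
    by (intro measurable_continuous_circle continuous_intros) auto
  have "(\<integral>\<^sup>+z. ennreal (norm (F z - g z)) \<partial>circle_measure) < ennreal \<epsilon>"
    using nn_integral_le_ext_norm assms(3) by (rule le_less_trans)
  note lt = this
  \<comment> \<open>Only the difference is known to have finite L1 norm; adding back the bounded
    \<open>g\<close> shows that the coefficient of \<open>F\<close> is a genuine integral, not the
    default 0.\<close>
  have int: "integrable circle_measure (\<lambda>z. F z - g z)"
    using less_trans[OF lt ennreal_less_top] by (intro integrableI_bounded) simp_all
  have norm_powi: "norm (z powi (- n)) = 1" if "norm z = 1" for z :: complex
    using that by (simp add: norm_power_int)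
  have int': "integrable circle_measure (\<lambda>z. (F z - g z) * z powi (- n))"
    by (rule Bochner_Integration.integrable_bound[OF int])
      (auto simp: norm_mult norm_powi intro!: AE_I2)
  have intg: "integrable circle_measure (\<lambda>z. g z * z powi (- n))"
    by (rule Bochner_Integration.integrable_bound[OF Linf_integrable[OF assms(2)]])
      (auto simp: norm_mult norm_powi intro!: AE_I2)
  have "fourier_coeff F n = (\<integral>z. (F z - g z) * z powi (- n) + g z * z powi (- n) \<partial>circle_measure)"
    by (simp add: fourier_coeff_def algebra_simps)
  also have "\<dots> = (\<integral>z. (F z - g z) * z powi (- n) \<partial>circle_measure) + fourier_coeff g n"
    using int' intg by (simp add: fourier_coeff_def)
  finally have "norm (fourier_coeff F n - fourier_coeff g n) \<le>
      (\<integral>z. norm ((F z - g z) * z powi (- n)) \<partial>circle_measure)"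
    by simp
  also have "\<dots> = (\<integral>z. norm (F z - g z) \<partial>circle_measure)"
    by (intro Bochner_Integration.integral_cong) (auto simp: norm_mult norm_powi)
  finally have "ennreal (norm (fourier_coeff F n - fourier_coeff g n)) \<le> ennreal (\<integral>z. norm (F z - g z) \<partial>circle_measure)"
    by (rule ennreal_leI)
  also have "\<dots> = (\<integral>\<^sup>+z. ennreal (norm (F z - g z)) \<partial>circle_measure)"
    using int by (intro nn_integral_eq_integral[symmetric] integrable_norm) auto
  also note lt
  finally show ?thesis
    using ennreal_less_iff[of "norm (fourier_coeff F n - fourier_coeff g n)" \<epsilon>] by simp
qed

section \<open>The two inclusions\<close>

lemma L_space_measurable: "F \<in> L_space \<alpha> \<Longrightarrow> F \<in> borel_measurable circle_measure"
  by (simp add: L_space_def norm_closure_def script_L_def)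

lemma L_space_approx:
  assumes "F \<in> L_space \<alpha>" "0 < \<epsilon>"
  obtains S c where "finite S" "ext_norm \<alpha> (\<lambda>z. F z - trig S c z) < ennreal \<epsilon>"
proof -
  obtain g where g: "g \<in> Linf" "ext_norm \<alpha> (\<lambda>z. F z - g z) < ennreal (\<epsilon> / 2)"
    using assms half_gt_zero unfolding L_space_def norm_closure_def by blast
  obtain S c where S: "finite S" "\<alpha> (\<lambda>z. g z - trig S c z) < \<epsilon> / 2"
    using solid.approx_Linf[OF g(1)] assms(2) half_gt_zero unfolding solid.approx_def by blast
  have "ext_norm \<alpha> (\<lambda>z. F z - trig S c z) \<le>
      ext_norm \<alpha> (\<lambda>z. F z - g z) + ext_norm \<alpha> (\<lambda>z. g z - trig S c z)"
    by (intro ext_norm_diff_triangle L_space_measurable[OF assms(1)] Linf_measurable g Linf_trig)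
  also have "\<dots> \<le> ext_norm \<alpha> (\<lambda>z. F z - g z) + ennreal (\<epsilon> / 2)"
    using S(2) by (intro add_left_mono order_trans[OF ext_norm_le] ennreal_leI Linf_diff g Linf_trig) simp
  also have "\<dots> < ennreal (\<epsilon> / 2) + ennreal (\<epsilon> / 2)"
    using g(2) by (simp add: add.commute ennreal_add_left_cancel_less)
  also have "\<dots> = ennreal \<epsilon>"
    using assms(2) by (simp flip: ennreal_plus)
  finally show ?thesis using S(1) by (intro that)
qed

lemma fourier_coeff_H_space:
  assumes "F \<in> H_space \<alpha>" "n < 0"
  shows "fourier_coeff F n = 0"
proof -
  have "norm (fourier_coeff F n) \<le> 0"
  proof (rule field_le_epsilon)
    fix \<epsilon> :: real assume "0 < \<epsilon>"
    then obtain p :: "complex poly" where p: "ext_norm \<alpha> (\<lambda>z. F z - poly p z) < ennreal \<epsilon>"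
      using assms(1) unfolding H_space_def norm_closure_def by blast
    have "poly p = trig (int ` {..degree p}) (\<lambda>n. coeff p (nat n))"
      by (simp add: fun_eq_iff trig_def poly_altdef sum.reindex)
    moreover have "n \<notin> int ` {..degree p}" using assms(2) by auto
    ultimately have "fourier_coeff (poly p) n = 0"
      by (simp add: fourier_coeff_trig)
    moreover have "F \<in> borel_measurable circle_measure"
      using assms(1) by (simp add: H_space_def norm_closure_def script_L_def)
    ultimately show "norm (fourier_coeff F n) \<le> 0 + \<epsilon>"
      using fourier_coeff_diff_le[OF _ Linf_poly p, of n] by simp
  qed
  then show ?thesis by simp
qed

text \<open>The Fejer means of \<open>F\<close> itself are never formed. The degree \<open>N\<close> is fixed by a trigonometric polynomial
  \<open>p\<close> close to \<open>F\<close>; the Fejer mean of order \<open>N\<close> is then applied to a second approximation \<open>p'\<close>,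
  so close to \<open>F\<close> that the at most \<open>N\<close> surviving negative frequencies are negligible.\<close>

lemma H_space_if_fourier_coeff:
  assumes F: "F \<in> L_space \<alpha>" and coeff: "\<And>n. n < 0 \<Longrightarrow> fourier_coeff F n = 0"
  shows "F \<in> H_space \<alpha>"
proof -
  note F_meas = L_space_measurable[OF F]
  have "\<exists>g\<in>range (poly :: complex poly \<Rightarrow> complex \<Rightarrow> complex). ext_norm \<alpha> (\<lambda>z. F z - g z) < ennreal \<epsilon>"
    if "0 < \<epsilon>" for \<epsilon>
  proof -
    \<comment> \<open>One \<delta> is spent between \<open>F\<close> and p, and three between p and
      \<open>q\<close>: the bounds \<delta>, \<delta> + \<eta> and N \<eta> below add up to 3
      \<delta>.\<close>
    define \<delta> where "\<delta> = \<epsilon> / 4"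
    have \<delta>: "0 < \<delta>" using that by (simp add: \<delta>_def)
    obtain S c where S: "finite S" and p: "ext_norm \<alpha> (\<lambda>z. F z - trig S c z) < ennreal \<delta>"
      using L_space_approx[OF F \<delta>] .
    \<comment> \<open>By \<open>one_minus_fejer_le\<close> this \<open>N\<close> makes the Fejer
      mean of p uniformly \<delta>-close to p.\<close>
    obtain N :: nat where N: "(\<Sum>n\<in>S. \<bar>of_int n\<bar> * norm (c n)) / \<delta> < real N"
      using reals_Archimedean2 by blast
    have "0 \<le> (\<Sum>n\<in>S. \<bar>of_int n\<bar> * norm (c n)) / \<delta>"
      using \<delta> by (intro divide_nonneg_pos sum_nonneg) auto
    with N have N0: "0 < N" by linarith
    \<comment> \<open>\<delta> is cut into N + 1 shares: one for the distance from \<open>F\<close>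
      to p', and one for each frequency from -N to -1.\<close>
    define \<eta> where "\<eta> = \<delta> / (real N + 1)"
    have "(real N + 1) * \<eta> = \<delta>" by (simp add: \<eta>_def)
    then have \<eta>_N: "\<eta> + real N * \<eta> = \<delta>" by (simp only: distrib_right mult_1 add.commute)
    have "0 < \<eta>" using \<delta> by (simp add: \<eta>_def)
    note \<eta> = this \<eta>_N
    obtain T d where T: "finite T" and p': "ext_norm \<alpha> (\<lambda>z. F z - trig T d z) < ennreal \<eta>"
      using L_space_approx[OF F \<eta>(1)] .
    define \<sigma> where "\<sigma> = (\<lambda>c n. complex_of_real (fejer N n) * c n)"
    \<comment> \<open>The Fejer mean of p' with its negative frequencies deleted.\<close>
    define q where "q = (\<Sum>n\<in>T \<inter> {0..}. monom (\<sigma> d n) (nat n))"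
    have q: "poly q z = trig (T \<inter> {0..}) (\<sigma> d) z" for z
      unfolding q_def trig_def poly_sum
      by (intro sum.cong) (auto simp: poly_monom power_int_nonneg_exp)

    have 1: "\<alpha> (\<lambda>z. trig S c z - trig S (\<sigma> c) z) \<le> \<delta>"
    proof -
      have "norm (trig S c z - trig S (\<sigma> c) z) \<le> \<delta>" if "norm z = 1" for z
      proof -
        have "norm (trig S c z - trig S (\<sigma> c) z) = norm (\<Sum>n\<in>S. of_real (1 - fejer N n) * (c n * z powi n))"
          by (simp add: trig_def \<sigma>_def sum_subtractf algebra_simps)
        also have "\<dots> \<le> (\<Sum>n\<in>S. norm (of_real (1 - fejer N n) * (c n * z powi n)))"
          by (rule norm_sum)
        also have "\<dots> \<le> (\<Sum>n\<in>S. \<bar>of_int n\<bar> * norm (c n) / real N)"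
        proof (rule sum_mono)
          fix n
          have "norm (of_real (1 - fejer N n) * (c n * z powi n)) = (1 - fejer N n) * norm (c n)"
            using that fejer_le_1[of N n]
            by (simp only: norm_mult norm_of_real norm_power_int) simp
          also have "\<dots> \<le> (\<bar>of_int n\<bar> / real N) * norm (c n)"
            by (intro mult_right_mono one_minus_fejer_le N0) simp
          finally show "norm (of_real (1 - fejer N n) * (c n * z powi n)) \<le> \<bar>of_int n\<bar> * norm (c n) / real N"
            by simp
        qed
        also have "\<dots> = (\<Sum>n\<in>S. \<bar>of_int n\<bar> * norm (c n)) / real N"
          by (simp add: sum_divide_distrib)
        also have "\<dots> \<le> \<delta>"
          using N N0 \<delta> by (simp add: field_simps)
        finally show ?thesis .
      qed
      then have "\<alpha> (\<lambda>z. trig S c z - trig S (\<sigma> c) z) \<le> \<delta> * \<alpha> (\<lambda>z. 1)"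
        using \<delta> by (intro solid.le_const Linf_diff Linf_trig) auto
      then show ?thesis by (simp add: norm_one)
    qed

    \<comment> \<open>Both means are put on one frequency set so that contraction applies to their
      difference; p and p' are then compared through \<open>F\<close> in the extended norm, and
      \<open>le_ext_norm\<close> returns to \<alpha>.\<close>
    have 2: "\<alpha> (\<lambda>z. trig S (\<sigma> c) z - trig T (\<sigma> d) z) \<le> \<delta> + \<eta>"
    proof -
      define U where "U = S \<union> T"
      define e where "e = (\<lambda>n. (if n \<in> S then c n else 0) - (if n \<in> T then d n else 0))"
      have U: "finite U" "S \<subseteq> U" "T \<subseteq> U" using S T by (auto simp: U_def)
      have e: "trig S c z - trig T d z = trig U e z" for z
        unfolding trig_superset[OF U(1,2), symmetric] trig_superset[OF U(1,3), symmetric]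
        by (simp add: trig_diff e_def)
      have \<sigma>e: "trig S (\<sigma> c) z - trig T (\<sigma> d) z = trig U (\<sigma> e) z" for z
      proof -
        have "(\<lambda>n. (if n \<in> S then \<sigma> c n else 0) - (if n \<in> T then \<sigma> d n else 0)) = \<sigma> e"
          by (auto simp: \<sigma>_def e_def fun_eq_iff algebra_simps)
        then show ?thesis
          unfolding trig_superset[OF U(1,2), symmetric] trig_superset[OF U(1,3), symmetric]
          by (simp only: trig_diff)
      qed
      have "\<alpha> (\<lambda>z. trig S (\<sigma> c) z - trig T (\<sigma> d) z) = \<alpha> (trig U (\<sigma> e))"
        unfolding \<sigma>e by simp
      also have "\<dots> \<le> \<alpha> (trig U e)"
        unfolding \<sigma>_def by (rule fejer_contraction[OF U(1) N0])
      finally have "ennreal (\<alpha> (\<lambda>z. trig S (\<sigma> c) z - trig T (\<sigma> d) z)) \<le> ennreal (\<alpha> (trig U e))"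
        by (rule ennreal_leI)
      also have "\<dots> \<le> ext_norm \<alpha> (\<lambda>z. trig S c z - trig T d z)"
        unfolding e by (rule le_ext_norm[OF Linf_trig])
      also have "\<dots> \<le> ext_norm \<alpha> (\<lambda>z. trig S c z - F z) + ext_norm \<alpha> (\<lambda>z. F z - trig T d z)"
        by (intro ext_norm_diff_triangle F_meas Linf_measurable Linf_trig)
      also have "\<dots> \<le> ennreal \<delta> + ennreal \<eta>"
        using p p' unfolding ext_norm_diff_commute[of _ F] by (intro add_mono) auto
      also have "\<dots> = ennreal (\<delta> + \<eta>)"
        using \<delta> \<eta> by simp
      finally show ?thesis
        using \<delta> \<eta> by (simp add: ennreal_le_iff del: ennreal_plus)
    qed

    \<comment> \<open>The multiplier vanishes from -N downward. Each remaining negative coefficient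
      of p' is within \<eta> of that of \<open>F\<close>, which is 0, and the multiplier is at most
      1.\<close>
    have 3: "\<alpha> (\<lambda>z. trig T (\<sigma> d) z - poly q z) \<le> real N * \<eta>"
    proof -
      have "norm (trig T (\<sigma> d) z - poly q z) \<le> real N * \<eta>" if "norm z = 1" for z
      proof -
        have "trig T (\<sigma> d) z - poly q z = (\<Sum>n\<in>T - {0..}. \<sigma> d n * z powi n)"
          using sum.Int_Diff[OF T, of "\<lambda>n. \<sigma> d n * z powi n" "{0..}"] by (simp add: q trig_def)
        also have "\<dots> = (\<Sum>n\<in>T \<inter> {- int N..<0}. \<sigma> d n * z powi n)"
        proof (rule sum.mono_neutral_right)
          show "\<forall>n\<in>T - {0..} - T \<inter> {- int N..<0}. \<sigma> d n * z powi n = 0"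
            by (auto simp: \<sigma>_def intro!: fejer_eq_0)
        qed (use T in auto)
        also have "norm \<dots> \<le> (\<Sum>n\<in>T \<inter> {- int N..<0}. norm (\<sigma> d n * z powi n))"
          by (rule norm_sum)
        also have "\<dots> \<le> (\<Sum>n\<in>T \<inter> {- int N..<0}. \<eta>)"
        proof (rule sum_mono)
          fix n assume n: "n \<in> T \<inter> {- int N..<0}"
          have "norm (\<sigma> d n * z powi n) = fejer N n * norm (d n)"
            using that by (simp add: \<sigma>_def norm_mult norm_power_int fejer_nonneg)
          also have "\<dots> \<le> 1 * norm (d n)"
            by (intro mult_right_mono fejer_le_1) simp
          also have "\<dots> \<le> \<eta>"
            using fourier_coeff_diff_le[OF F_meas Linf_trig p', of n] n coeff[of n]
            by (simp add: fourier_coeff_trig[OF T])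
          finally show "norm (\<sigma> d n * z powi n) \<le> \<eta>" .
        qed
        also have "\<dots> \<le> real N * \<eta>"
          using card_mono[of "{- int N..<0}" "T \<inter> {- int N..<0}"] \<eta>(1) by simp
        finally show ?thesis .
      qed
      then have "\<alpha> (\<lambda>z. trig T (\<sigma> d) z - poly q z) \<le> real N * \<eta> * \<alpha> (\<lambda>z. 1)"
        using \<eta> by (intro solid.le_const Linf_diff Linf_trig Linf_poly) auto
      then show ?thesis by (simp add: norm_one)
    qed

    have "\<alpha> (\<lambda>z. trig S c z - poly q z) \<le> 3 * \<delta>"
      using solid.diff_triangle[OF Linf_trig[of S c] Linf_trig[of S "\<sigma> c"] Linf_poly[of q]]
        solid.diff_triangle[OF Linf_trig[of S "\<sigma> c"] Linf_trig[of T "\<sigma> d"] Linf_poly[of q]]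
        1 2 3 \<eta>(2) by linarith
    then have pq: "ext_norm \<alpha> (\<lambda>z. trig S c z - poly q z) \<le> ennreal (3 * \<delta>)"
      by (intro order_trans[OF ext_norm_le] ennreal_leI Linf_diff Linf_trig Linf_poly)
    have "ext_norm \<alpha> (\<lambda>z. F z - poly q z) \<le>
        ext_norm \<alpha> (\<lambda>z. F z - trig S c z) + ext_norm \<alpha> (\<lambda>z. trig S c z - poly q z)"
      by (intro ext_norm_diff_triangle F_meas Linf_measurable Linf_trig Linf_poly)
    also have "\<dots> \<le> ext_norm \<alpha> (\<lambda>z. F z - trig S c z) + ennreal (3 * \<delta>)"
      by (intro add_left_mono pq)
    also have "\<dots> < ennreal \<delta> + ennreal (3 * \<delta>)"
      using p by (simp add: add.commute[of _ "ennreal (3 * \<delta>)"] ennreal_add_left_cancel_less)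
    also have "\<dots> = ennreal \<epsilon>"
      using \<delta> by (simp add: \<delta>_def flip: ennreal_plus)
    finally show ?thesis by blast
  qed
  then show ?thesis
    using F by (simp add: H_space_def L_space_def norm_closure_def)
qed

lemma H_space_subset_L_space: "H_space \<alpha> \<subseteq> L_space \<alpha>"
  unfolding H_space_def L_space_def norm_closure_def using Linf_poly by blast

end

theorem theorem6p1:
  fixes \<alpha> :: "(complex \<Rightarrow> complex) \<Rightarrow> real"
  assumes "continuous_rotationally_symmetric_norm \<alpha>"
  shows "H_space \<alpha> = {F \<in> L_space \<alpha>. \<forall>n<0. fourier_coeff F n = 0}"
proof -
  interpret continuous_rotationally_symmetric_norm \<alpha> by (rule assms)
  show ?thesis
    using H_space_subset_L_space fourier_coeff_H_space H_space_if_fourier_coeff by blast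
qed

end
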